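(* There is a computable structure of Scott rank $\omega_1^{CK}+1$ with no indiscernible ordered triple.
   Context: Structures are countable, for computable languages. $\omega_1^{CK}$ is the least non-computable ordinal. Scott rank. For tuples $\bar a,\bar b$ of the same finite length in a structure $\mathcal{A}$: $\bar a\sim^0\bar b$ if $\bar a$ and $\bar b$ satisfy the same atomic formulas; for $\alpha>0$, $\bar a\sim^\alpha\bar b$ if for each $\beta<\alpha$, for each tuple $\bar c$ there exists $\bar d$, and for each $\bar d$ there exists $\bar c$, such that $\bar a,\bar c\sim^\beta\bar b,\bar d$. The Scott rank of a tuple $\bar a$ is the least $\alpha$ such that for all $\bar b$, if $\bar a\sim^\alpha\bar b$ then $\bar a\sim^\gamma\bar b$ for all $\gamma>\alpha$. The Scott rank of $\mathcal{A}$ is the least ordinal greater than the Scott ranks of all tuples in $\mathcal{A}$. An indiscernible ordered triple in $\mathcal{A}$ is a sequence $(a_1,a_2,a_3)$ of three pairwise distinct elements of $\mathcal{A}$ such that for any $n$ and any $i_1<\dots<i_n$ and $j_1<\dots<j_n$ in $\{1,2,3\}$, the tuples $(a_{i_1},\ldots,a_{i_n})$ and $(a_{j_1},\ldots,a_{j_n})$ satisfy the same $L_{\omega_1\omega}$ formulas in $\mathcal{A}$. *)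

theory Defs
  imports "HOL-Library.Nat_Bijection" "HOL-Library.Countable_Set_Type"
begin

section \<open>Computability\<close>

text \<open>
  Partial recursive functions of any arity. The first argument of \<open>Prec\<close> and \<open>Mu\<close>
  is the recursion and the search variable, respectively.
\<close>

datatype recf = Zero | Succ | Proj nat | Comp recf "recf list" | Prec recf recf | Mu recf

inductive evals :: "recf \<Rightarrow> nat list \<Rightarrow> nat \<Rightarrow> bool" where
  "evals Zero xs 0"
| "evals Succ [x] (Suc x)"
| "i < length xs \<Longrightarrow> evals (Proj i) xs (xs ! i)"
| "list_all2 (\<lambda>g y. evals g xs y) gs ys \<Longrightarrow> evals f ys z \<Longrightarrow> evals (Comp f gs) xs z"
| "evals f xs y \<Longrightarrow> evals (Prec f g) (0 # xs) y"
| "evals (Prec f g) (n # xs) y \<Longrightarrow> evals g (n # y # xs) z \<Longrightarrow> evals (Prec f g) (Suc n # xs) z"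
| "evals f (n # xs) 0 \<Longrightarrow> (\<forall>m<n. \<exists>k. evals f (m # xs) (Suc k)) \<Longrightarrow> evals (Mu f) xs n"

definition computable_fun :: "(nat \<Rightarrow> nat) \<Rightarrow> bool" where
  "computable_fun f \<longleftrightarrow> (\<exists>p. \<forall>x. evals p [x] (f x))"

definition computable_set :: "nat set \<Rightarrow> bool" where
  "computable_set A \<longleftrightarrow> computable_fun (\<lambda>x. of_bool (x \<in> A))"


section \<open>Countable ordinals\<close>

text \<open>
  The type \<open>cord\<close> is the set of ordinals below \<open>\<omega>\<^sub>1\<close>: an initial well-order of the least
  uncountable cardinality. The ordinal \<open>\<alpha> :: cord\<close> is the order type of \<open>{\<beta>. \<beta> < \<alpha>}\<close>.
  All computable ordinals are countable, and so are all Scott ranks of countable structures.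
\<close>

lemma Card_order_cardSuc_natLeq: "Card_order (cardSuc natLeq)"
  by (simp add: cardSuc_Card_order natLeq_Card_order)

lemma Well_order_cardSuc_natLeq: "Well_order (cardSuc natLeq)"
  using Card_order_cardSuc_natLeq card_order_on_well_order_on by blast

lemma not_countable_Field_cardSuc_natLeq:
  includes cardinal_syntax
  shows "\<not> countable (Field (cardSuc natLeq))"
proof
  assume "countable (Field (cardSuc natLeq))"
  then have "|Field (cardSuc natLeq)| \<le>o natLeq"
    by (simp add: countable_card_le_natLeq)
  then have "cardSuc natLeq \<le>o natLeq"
    using card_of_Field_ordIso[OF Card_order_cardSuc_natLeq] ordIso_ordLeq_trans ordIso_symmetric
    by blast
  then show False
    using cardSuc_greater[OF natLeq_Card_order] not_ordLess_ordLeq by blast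
qed

typedef cord = "Field (cardSuc natLeq)"
  using not_countable_Field_cardSuc_natLeq by (metis countable_empty ex_in_conv)

instantiation cord :: wellorder
begin

definition less_eq_cord :: "cord \<Rightarrow> cord \<Rightarrow> bool" where
  "less_eq_cord \<alpha> \<beta> \<longleftrightarrow> (Rep_cord \<alpha>, Rep_cord \<beta>) \<in> cardSuc natLeq"

definition less_cord :: "cord \<Rightarrow> cord \<Rightarrow> bool" where
  "less_cord \<alpha> \<beta> \<longleftrightarrow> \<alpha> \<le> \<beta> \<and> \<alpha> \<noteq> \<beta>"

instance
proof
  let ?r = "cardSuc natLeq"
  have lin: "Linear_order ?r" and wf: "wf (?r - Id)"
    using Well_order_cardSuc_natLeq by (auto simp: well_order_on_def)
  have part: "refl_on (Field ?r) ?r" "trans ?r" "antisym ?r" "total_on (Field ?r) ?r"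
    using lin by (auto simp: linear_order_on_def partial_order_on_def preorder_on_def)
  fix x y z :: cord
  show le_antisym: "x \<le> y \<Longrightarrow> y \<le> x \<Longrightarrow> x = y" for x y :: cord
    unfolding less_eq_cord_def by (metis antisymD[OF part(3)] Rep_cord_inject)
  show "x < y \<longleftrightarrow> x \<le> y \<and> \<not> y \<le> x"
    using le_antisym part(1) by (auto simp: less_cord_def less_eq_cord_def refl_on_def Rep_cord)
  show "x \<le> x"
    using part(1) by (auto simp: less_eq_cord_def refl_on_def Rep_cord)
  show "x \<le> y \<Longrightarrow> y \<le> z \<Longrightarrow> x \<le> z"
    using part(2) unfolding less_eq_cord_def trans_def by blast
  show "x \<le> y \<or> y \<le> x"
    using part(1,4) Rep_cord[of x] Rep_cord[of y] unfolding less_eq_cord_def total_on_def refl_on_def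
    by metis
next
  fix P :: "cord \<Rightarrow> bool" and a :: cord
  assume step: "\<And>x. (\<And>y. y < x \<Longrightarrow> P y) \<Longrightarrow> P x"
  have wf: "wf (inv_image (cardSuc natLeq - Id) Rep_cord)"
    using Well_order_cardSuc_natLeq by (auto simp: well_order_on_def)
  show "P a"
    using wf
  proof (induction a rule: wf_induct_rule)
    case (less x)
    show ?case
      by (rule step, rule less)
        (auto simp: less_cord_def less_eq_cord_def inv_image_def Rep_cord_inject)
  qed
qed

end

instantiation cord :: zero
begin

definition zero_cord :: cord where
  "0 = (LEAST \<alpha> :: cord. True)"

instance ..

end

lemma not_countable_UNIV_cord: "\<not> countable (UNIV :: cord set)"
proof
  assume "countable (UNIV :: cord set)"
  then have "countable (range Rep_cord)" by (rule countable_image)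
  then show False
    using not_countable_Field_cardSuc_natLeq by (simp add: type_definition.Rep_range[OF type_definition_cord])
qed

lemma countable_below_cord:
  includes cardinal_syntax
  shows "countable {\<beta>. \<beta> < (\<alpha> :: cord)}"
proof -
  have "|underS (cardSuc natLeq) (Rep_cord \<alpha>)| <o cardSuc natLeq"
    by (rule card_of_underS[OF Card_order_cardSuc_natLeq Rep_cord])
  then have "|underS (cardSuc natLeq) (Rep_cord \<alpha>)| \<le>o natLeq"
    using cardSuc_ordLeq_ordLess[OF natLeq_Card_order card_of_Card_order] by blast
  then have "countable (underS (cardSuc natLeq) (Rep_cord \<alpha>))"
    by (simp add: countable_card_le_natLeq)
  moreover have "Rep_cord ` {\<beta>. \<beta> < \<alpha>} \<subseteq> underS (cardSuc natLeq) (Rep_cord \<alpha>)"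
    by (auto simp: underS_def less_cord_def less_eq_cord_def Rep_cord_inject)
  ultimately have "countable (Rep_cord ` {\<beta>. \<beta> < \<alpha>})"
    by (rule countable_subset[rotated])
  then show ?thesis
    by (rule countable_image_inj_on) (auto simp: inj_on_def Rep_cord_inject)
qed

definition cord_succ :: "cord \<Rightarrow> cord" where
  "cord_succ \<alpha> = (LEAST \<beta>. \<alpha> < \<beta>)"

definition computable_ordinal :: "cord \<Rightarrow> bool" where
  "computable_ordinal \<alpha> \<longleftrightarrow>
     (\<exists>D R f. computable_set D \<and> computable_set (prod_encode ` R) \<and> R \<subseteq> D \<times> D \<and>
        bij_betw f D {\<beta>. \<beta> < \<alpha>} \<and> (\<forall>x\<in>D. \<forall>y\<in>D. (x, y) \<in> R \<longleftrightarrow> f x < f y))"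

definition omega1_CK :: cord where
  "omega1_CK = (LEAST \<alpha>. \<not> computable_ordinal \<alpha>)"


section \<open>Languages, structures and infinitary formulas\<close>

text \<open>
  Symbols are natural numbers; constants are function symbols of arity \<open>0\<close>.
  Only the arities of symbols that belong to the language matter.
\<close>

record language =
  Rels :: "nat set"
  Funs :: "nat set"
  rel_arity :: "nat \<Rightarrow> nat"
  fun_arity :: "nat \<Rightarrow> nat"

record 'a struct =
  univ :: "'a set"
  rel :: "nat \<Rightarrow> 'a list \<Rightarrow> bool"
  fn :: "nat \<Rightarrow> 'a list \<Rightarrow> 'a"

definition is_structure :: "language \<Rightarrow> 'a struct \<Rightarrow> bool" where
  "is_structure L M \<longleftrightarrow> univ M \<noteq> {} \<and>
     (\<forall>f\<in>Funs L. \<forall>as\<in>lists (univ M). length as = fun_arity L f \<longrightarrow> fn M f as \<in> univ M)"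

datatype trm = Var nat | Fn nat "trm list"

datatype fm =
    Eq trm trm
  | Rel nat "trm list"
  | Neg fm
  | Conj "nat set" "nat \<Rightarrow> fm"  \<comment> \<open>\<open>Conj I F\<close> is the conjunction of the \<open>F i\<close> with \<open>i \<in> I\<close>\<close>
  | Ex nat fm

primrec eval_trm :: "'a struct \<Rightarrow> (nat \<Rightarrow> 'a) \<Rightarrow> trm \<Rightarrow> 'a" where
  "eval_trm M e (Var x) = e x"
| "eval_trm M e (Fn f ts) = fn M f (map (eval_trm M e) ts)"

primrec sat :: "'a struct \<Rightarrow> fm \<Rightarrow> (nat \<Rightarrow> 'a) \<Rightarrow> bool" where
  "sat M (Eq s t) e \<longleftrightarrow> eval_trm M e s = eval_trm M e t"
| "sat M (Rel r ts) e \<longleftrightarrow> rel M r (map (eval_trm M e) ts)"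
| "sat M (Neg \<phi>) e \<longleftrightarrow> \<not> sat M \<phi> e"
| "sat M (Conj I F) e \<longleftrightarrow> (\<forall>i\<in>I. sat M (F i) e)"
| "sat M (Ex x \<phi>) e \<longleftrightarrow> (\<exists>a\<in>univ M. sat M \<phi> (e(x := a)))"

primrec wf_trm :: "language \<Rightarrow> trm \<Rightarrow> bool" where
  "wf_trm L (Var x) \<longleftrightarrow> True"
| "wf_trm L (Fn f ts) \<longleftrightarrow> f \<in> Funs L \<and> length ts = fun_arity L f \<and> list_all (wf_trm L) ts"

primrec wf_fm :: "language \<Rightarrow> fm \<Rightarrow> bool" where
  "wf_fm L (Eq s t) \<longleftrightarrow> wf_trm L s \<and> wf_trm L t"
| "wf_fm L (Rel r ts) \<longleftrightarrow> r \<in> Rels L \<and> length ts = rel_arity L r \<and> list_all (wf_trm L) ts"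
| "wf_fm L (Neg \<phi>) \<longleftrightarrow> wf_fm L \<phi>"
| "wf_fm L (Conj I F) \<longleftrightarrow> (\<forall>i\<in>I. wf_fm L (F i))"
| "wf_fm L (Ex x \<phi>) \<longleftrightarrow> wf_fm L \<phi>"

primrec fv_trm :: "trm \<Rightarrow> nat set" where
  "fv_trm (Var x) = {x}"
| "fv_trm (Fn f ts) = \<Union> (set (map fv_trm ts))"

primrec fv :: "fm \<Rightarrow> nat set" where
  "fv (Eq s t) = fv_trm s \<union> fv_trm t"
| "fv (Rel r ts) = \<Union> (fv_trm ` set ts)"
| "fv (Neg \<phi>) = fv \<phi>"
| "fv (Conj I F) = (\<Union>i\<in>I. fv (F i))"
| "fv (Ex x \<phi>) = fv \<phi> - {x}"

primrec atomic :: "fm \<Rightarrow> bool" where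
  "atomic (Eq s t) \<longleftrightarrow> True"
| "atomic (Rel r ts) \<longleftrightarrow> True"
| "atomic (Neg \<phi>) \<longleftrightarrow> False"
| "atomic (Conj I F) \<longleftrightarrow> False"
| "atomic (Ex x \<phi>) \<longleftrightarrow> False"

text \<open>
  The \<open>L\<^sub>\<omega>\<^sub>1\<^sub>\<omega>\<close> formulas in the variables \<open>x\<^sub>0, \<dots>, x\<^sub>n\<^sub>-\<^sub>1\<close>. As the free variables are finitely
  many, so are those of every subformula. A tuple \<open>as\<close> of length \<open>n\<close> satisfies
  such a formula \<open>\<phi>\<close> if \<open>sat M \<phi> ((!) as)\<close>; entries beyond \<open>n\<close> do not matter.
\<close>

definition formulas :: "language \<Rightarrow> nat \<Rightarrow> fm set" where
  "formulas L n = {\<phi>. wf_fm L \<phi> \<and> fv \<phi> \<subseteq> {..<n}}"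

definition same_formulas :: "language \<Rightarrow> 'a struct \<Rightarrow> 'a list \<Rightarrow> 'a list \<Rightarrow> bool" where
  "same_formulas L M as bs \<longleftrightarrow> length as = length bs \<and>
     (\<forall>\<phi>\<in>formulas L (length as). sat M \<phi> ((!) as) \<longleftrightarrow> sat M \<phi> ((!) bs))"

definition same_atomic :: "language \<Rightarrow> 'a struct \<Rightarrow> 'a list \<Rightarrow> 'a list \<Rightarrow> bool" where
  "same_atomic L M as bs \<longleftrightarrow> length as = length bs \<and>
     (\<forall>\<phi>\<in>formulas L (length as). atomic \<phi> \<longrightarrow> (sat M \<phi> ((!) as) \<longleftrightarrow> sat M \<phi> ((!) bs)))"


section \<open>Computable structures\<close>

definition computable_language :: "language \<Rightarrow> bool" where
  "computable_language L \<longleftrightarrow> computable_set (Rels L) \<and> computable_set (Funs L) \<and>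
     computable_fun (rel_arity L) \<and> computable_fun (fun_arity L)"

text \<open>
  The universe is a computable set of natural numbers, and the relations and functions are
  computable uniformly in their symbols.
\<close>

definition computable_structure :: "language \<Rightarrow> nat struct \<Rightarrow> bool" where
  "computable_structure L M \<longleftrightarrow> is_structure L M \<and> computable_set (univ M) \<and>
     computable_set {prod_encode (r, list_encode as) | r as.
       r \<in> Rels L \<and> as \<in> lists (univ M) \<and> length as = rel_arity L r \<and> rel M r as} \<and>
     (\<exists>g. computable_fun g \<and>
       (\<forall>f\<in>Funs L. \<forall>as\<in>lists (univ M). length as = fun_arity L f \<longrightarrow>
          g (prod_encode (f, list_encode as)) = fn M f as))"


section \<open>Scott rank\<close>

function back_forth :: "language \<Rightarrow> 'a struct \<Rightarrow> cord \<Rightarrow> 'a list \<Rightarrow> 'a list \<Rightarrow> bool" where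
  "back_forth L M \<alpha> as bs \<longleftrightarrow> length as = length bs \<and>
     (if \<alpha> = 0 then same_atomic L M as bs
      else \<forall>\<beta><\<alpha>.
        (\<forall>cs\<in>lists (univ M). \<exists>ds\<in>lists (univ M).
           length cs = length ds \<and> back_forth L M \<beta> (as @ cs) (bs @ ds)) \<and>
        (\<forall>ds\<in>lists (univ M). \<exists>cs\<in>lists (univ M).
           length cs = length ds \<and> back_forth L M \<beta> (as @ cs) (bs @ ds)))"
  by auto
termination
  by (relation "inv_image {(\<beta>, \<alpha>). \<beta> < \<alpha>} (\<lambda>(L, M, \<alpha>, as, bs). \<alpha>)") (auto intro: wf_inv_image wf)

declare back_forth.simps [simp del]

text \<open>
  The ordinals \<open>\<gamma>\<close> and the ranks range over the countable ordinals. For a countable structure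
  the relations \<open>back_forth L M \<alpha>\<close> decrease with \<open>\<alpha>\<close> and are constant from some countable ordinal on,
  so larger ordinals would not change the ranks. For uncountable structures the two definitions
  below are not meaningful.
\<close>

definition tuple_scott_rank :: "language \<Rightarrow> 'a struct \<Rightarrow> 'a list \<Rightarrow> cord" where
  "tuple_scott_rank L M as =
     (LEAST \<alpha>. \<forall>bs\<in>lists (univ M). length bs = length as \<longrightarrow> back_forth L M \<alpha> as bs \<longrightarrow>
        (\<forall>\<gamma>>\<alpha>. back_forth L M \<gamma> as bs))"

definition scott_rank :: "language \<Rightarrow> 'a struct \<Rightarrow> cord" where
  "scott_rank L M = (LEAST \<alpha>. \<forall>as\<in>lists (univ M). tuple_scott_rank L M as < \<alpha>)"


section \<open>Indiscernible triples\<close>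

definition indiscernible_triple :: "language \<Rightarrow> 'a struct \<Rightarrow> (nat \<Rightarrow> 'a) \<Rightarrow> bool" where
  "indiscernible_triple L M a \<longleftrightarrow> a ` {1..3} \<subseteq> univ M \<and> inj_on a {1..3} \<and>
     (\<forall>is js. set is \<subseteq> {1..3} \<and> set js \<subseteq> {1..3} \<and> length is = length js \<and>
        sorted_wrt (<) is \<and> sorted_wrt (<) js \<longrightarrow>
        same_formulas L M (map a is) (map a js))"

end

theory Submission
  imports Defs "HOL-Library.Sublist"
begin

text \<open>
  Let \<open>R\<close> be a binary relation on the natural numbers; read \<open>(y', y) \<in> R\<close> as a step from \<open>y\<close> to \<open>y'\<close>.
  The walks with \<open>n\<close> steps form level \<open>n\<close> of a tree, in which a walk extends its truncations.
  The structure \<open>torsor R\<close> has as its elements of level \<open>n\<close> the finite sets of walks with \<open>n\<close> steps. They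
  form a vector space over the field with two elements, and truncation of walks induces linear maps
  between these spaces. The relation with index \<open>(n, d)\<close> holds of \<open>x\<close> and \<open>y\<close> if \<open>y\<close> has level \<open>n\<close>
  and differs by \<open>d\<close> from the image of \<open>x\<close> in level \<open>n\<close>.

  The differences between elements of a level are thus part of the structure. The members of an
  indiscernible triple would have the same level. As \<open>(a\<^sub>1, a\<^sub>2)\<close> and \<open>(a\<^sub>1, a\<^sub>3)\<close> satisfy the same formulas, \<open>a\<^sub>2\<close> and
  \<open>a\<^sub>3\<close> would differ from \<open>a\<^sub>1\<close> by the same set and be equal, a contradiction
  (\<open>torsor_no_indiscernible_triple\<close>).

  For the Scott rank, call a vertex \<open>y\<close> deep to \<open>\<alpha>\<close> if for all \<open>\<beta> < \<alpha>\<close> and all \<open>m\<close> some walk with \<open>m\<close> steps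
  leads from \<open>y\<close> to a vertex that is deep to \<open>\<beta>\<close>. Tuples that satisfy the same atomic
  formulas are translates of each other by a finite set \<open>h\<close> of walks. A new tuple at a higher
  level is answered by translating it by a lift of \<open>h\<close> to that level, so the tuples are
  \<open>\<alpha>\<close>-equivalent if and only if the walks in \<open>h\<close> end in vertices that are deep to \<open>\<alpha>\<close>
  (\<open>back_forth_imp_deep_shift\<close>, \<open>deep_shift_imp_back_forth\<close>).

  Let \<open>R\<close> be decidable. A vertex outside the well-founded part of \<open>R\<close> is deep to
  every ordinal. For any other \<open>y\<close> the Kleene-Brouwer ordering of the
  walks from \<open>y\<close> is a computable well-order, and its length bounds the depth of \<open>y\<close>. Hence depth
  \<open>\<omega>\<^sub>1\<^sup>C\<^sup>K\<close> implies depth \<open>\<gamma>\<close> for all \<open>\<gamma>\<close> (\<open>deep_omega1_CK\<close>), and every tuple has Scott rank at most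
  \<open>\<omega>\<^sub>1\<^sup>C\<^sup>K\<close>.

  It remains to find a decidable \<open>R\<close> with vertices of every depth below \<open>\<omega>\<^sub>1\<^sup>C\<^sup>K\<close> that are not deep to all
  ordinals (\<open>universal_graph_depths\<close>). Then no rank below \<open>\<omega>\<^sub>1\<^sup>C\<^sup>K\<close> is possible for the empty set in
  level \<open>0\<close>, because it is \<open>\<alpha>\<close>-equivalent, but not equivalent to all ordinals, to the singleton
  of such a vertex of depth \<open>\<alpha>\<close>. The graph \<open>universal_graph\<close> contains the descents through all computable orders at once. For
  it to be decidable, a step carries a certificate: the code of a derivation in the calculus
  \<open>evals\<close> which shows that the program that is the index of the order declares the step to be a descent.
\<close>

section \<open>Closure properties of the computable functions\<close>

abbreviation pfst :: "nat \<Rightarrow> nat" where "pfst z \<equiv> fst (prod_decode z)"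
abbreviation psnd :: "nat \<Rightarrow> nat" where "psnd z \<equiv> snd (prod_decode z)"

text \<open>
  The rules collected in \<open>computable\<close> have the form of introduction rules for functions \<open>\<lambda>e. \<dots>\<close> of a single
  number \<open>e\<close>, the code of the current values of all variables. Under a binder the variables become
  projections of the code, so that a goal such as \<open>computable_fun (\<lambda>e. \<dots>)\<close> is decomposed
  by unification alone.
\<close>

definition decidable :: "(nat \<Rightarrow> bool) \<Rightarrow> bool" where
  "decidable P \<longleftrightarrow> computable_fun (\<lambda>x. of_bool (P x))"

named_theorems computable

lemma evals_Proj: "i < length xs \<Longrightarrow> y = xs ! i \<Longrightarrow> evals (Proj i) xs y"
  by (auto intro: evals.intros)

lemma evals_Comp1: "evals g xs y \<Longrightarrow> evals f [y] z \<Longrightarrow> evals (Comp f [g]) xs z"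
  by (rule evals.intros(4)[where ys = "[y]"]) auto

lemma evals_Comp2:
  "evals g xs y \<Longrightarrow> evals h xs y' \<Longrightarrow> evals f [y, y'] z \<Longrightarrow> evals (Comp f [g, h]) xs z"
  by (rule evals.intros(4)[where ys = "[y, y']"]) auto

lemma evals_Prec:
  assumes "evals f xs a" and "\<And>i y. evals g (i # y # xs) (s i y)"
  shows "evals (Prec f g) (n # xs) (rec_nat a s n)"
  by (induction n) (auto intro: evals.intros assms)

lemma evals_Mu:
  assumes p: "\<And>s. evals p (s # xs) (h s)" and ex: "\<exists>s. h s = 0"
  shows "evals (Mu p) xs (LEAST s. h s = 0)"
proof (rule evals.intros(7))
  show "evals p ((LEAST s. h s = 0) # xs) 0"
    using p[of "LEAST s. h s = 0"] LeastI_ex[OF ex] by simp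
  show "\<forall>m<LEAST s. h s = 0. \<exists>k. evals p (m # xs) (Suc k)"
    using p by (metis not_less_Least not0_implies_Suc)
qed

lemma computable_fun_comp:
  assumes "computable_fun g" and "computable_fun f"
  shows "computable_fun (\<lambda>x. g (f x))"
  using assms evals_Comp1 unfolding computable_fun_def by meson

lemma computable_fun_comp2:
  assumes "\<And>x y. evals p [x, y] (h x y)" and "computable_fun f" and "computable_fun g"
  shows "computable_fun (\<lambda>x. h (f x) (g x))"
  using assms evals_Comp2 unfolding computable_fun_def by meson

lemma computable_id [computable]: "computable_fun (\<lambda>x. x)"
  unfolding computable_fun_def by (rule exI[of _ "Proj 0"]) (auto intro: evals_Proj)

lemma computable_Suc [computable]:
  assumes "computable_fun f" shows "computable_fun (\<lambda>x. Suc (f x))"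
proof (rule computable_fun_comp[OF _ assms])
  show "computable_fun Suc"
    unfolding computable_fun_def by (rule exI[of _ Succ]) (auto intro: evals.intros)
qed

lemma computable_const [computable]: "computable_fun (\<lambda>x. c)"
proof (induction c)
  case 0
  show ?case unfolding computable_fun_def by (rule exI[of _ Zero]) (auto intro: evals.intros)
qed (rule computable_Suc)

abbreviation addition :: recf where "addition \<equiv> Prec (Proj 0) (Comp Succ [Proj 1])"

lemma evals_add: "evals addition [x, y] (x + y)"
proof -
  have "evals addition [x, y] (rec_nat y (\<lambda>_. Suc) x)"
    by (rule evals_Prec) (auto intro!: evals_Comp1 evals_Proj evals.intros)
  moreover have "rec_nat y (\<lambda>_. Suc) x = x + y" by (induction x) auto
  ultimately show ?thesis by simp
qed

lemma evals_mult: "\<exists>p. \<forall>x y. evals p [x, y] (x * y)"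
proof (intro exI allI)
  fix x y
  have "evals (Prec Zero (Comp addition [Proj 1, Proj 2])) [x, y]
      (rec_nat 0 (\<lambda>_ a. a + y) x)"
    by (rule evals_Prec[OF evals.intros(1) evals_Comp2[OF evals_Proj evals_Proj evals_add]]) auto
  moreover have "rec_nat 0 (\<lambda>_ a. a + y) x = x * y" by (induction x) auto
  ultimately show "evals (Prec Zero (Comp addition [Proj 1, Proj 2])) [x, y]
      (x * y)" by simp
qed

lemma evals_pred: "evals (Prec Zero (Proj 0)) [x] (x - 1)"
proof -
  have "evals (Prec Zero (Proj 0)) [x] (rec_nat 0 (\<lambda>i _. i) x)"
    by (rule evals_Prec) (auto intro!: evals_Proj evals.intros)
  moreover have "rec_nat 0 (\<lambda>i _. i) x = x - 1" by (cases x) auto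
  ultimately show ?thesis by simp
qed

lemma evals_diff: "\<exists>p. \<forall>x y. evals p [x, y] (y - x)"
proof (intro exI allI)
  fix x y
  have "evals (Prec (Proj 0) (Comp (Prec Zero (Proj 0)) [Proj 1])) [x, y]
      (rec_nat y (\<lambda>_ a. a - 1) x)"
    by (rule evals_Prec) (auto intro!: evals_Comp1 evals_Proj evals_pred[simplified] evals.intros)
  moreover have "rec_nat y (\<lambda>_ a. a - 1) x = y - x" by (induction x) auto
  ultimately show "evals (Prec (Proj 0) (Comp (Prec Zero (Proj 0)) [Proj 1])) [x, y] (y - x)" by simp
qed

lemma evals_triangle: "\<exists>p. \<forall>x. evals p [x] (triangle x)"
proof (intro exI allI)
  fix x
  have "evals (Prec Zero (Comp Succ [Comp addition [Proj 1, Proj 0]])) [x]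
      (rec_nat 0 (\<lambda>i a. Suc (a + i)) x)"
    by (rule evals_Prec[OF evals.intros(1)
          evals_Comp1[OF evals_Comp2[OF evals_Proj evals_Proj evals_add] evals.intros(2)]]) auto
  moreover have "rec_nat 0 (\<lambda>i a. Suc (a + i)) x = triangle x" by (induction x) auto
  ultimately show "evals (Prec Zero (Comp Succ [Comp addition [Proj 1, Proj 0]])) [x]
      (triangle x)" by simp
qed

lemma evals_pair: "\<exists>p. \<forall>x y. evals p [x, y] (prod_encode (x, y))"
proof -
  obtain t where t: "\<And>x. evals t [x] (triangle x)" using evals_triangle by blast
  have "evals (Comp addition
      [Comp t [Comp addition [Proj 0, Proj 1]], Proj 0]) [x, y]
      (triangle (x + y) + x)" for x y
    by (rule evals_Comp2[OF evals_Comp1[OF evals_Comp2[OF evals_Proj evals_Proj evals_add] t]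
          evals_Proj evals_add]) auto
  then show ?thesis unfolding prod_encode_def by auto
qed

lemma computable_add [computable]:
  "computable_fun f \<Longrightarrow> computable_fun g \<Longrightarrow> computable_fun (\<lambda>x. f x + g x)"
  by (rule computable_fun_comp2[OF evals_add])

lemma computable_mult [computable]:
  "computable_fun f \<Longrightarrow> computable_fun g \<Longrightarrow> computable_fun (\<lambda>x. f x * g x)"
  using evals_mult computable_fun_comp2[of _ "(*)"] by blast

lemma computable_diff [computable]:
  "computable_fun f \<Longrightarrow> computable_fun g \<Longrightarrow> computable_fun (\<lambda>x. f x - g x)"
  using evals_diff computable_fun_comp2[of _ "\<lambda>x y. y - x"] by blast

lemma computable_triangle [computable]:
  "computable_fun f \<Longrightarrow> computable_fun (\<lambda>x. triangle (f x))"
  by (rule computable_fun_comp) (use evals_triangle in \<open>auto simp: computable_fun_def\<close>)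

lemma computable_pair [computable]:
  "computable_fun f \<Longrightarrow> computable_fun g \<Longrightarrow> computable_fun (\<lambda>x. prod_encode (f x, g x))"
  using evals_pair computable_fun_comp2[of _ "\<lambda>x y. prod_encode (x, y)"] by blast

text \<open>
  The sum of the components of a pair is the index of its diagonal, which a search finds;
  subtraction then yields the components.
\<close>

lemma Least_diagonal: "(LEAST s. Suc z - triangle (Suc s) = 0) = pfst z + psnd z"
proof (rule Least_equality)
  have z: "z = triangle (pfst z + psnd z) + pfst z"
    using prod_decode_inverse[of z] unfolding prod_encode_def by (simp add: case_prod_beta)
  show "Suc z - triangle (Suc (pfst z + psnd z)) = 0"
    by (subst (1) z) simp
  have mono: "a \<le> b \<Longrightarrow> triangle a \<le> triangle b" for a b
    by (rule lift_Suc_mono_le[of triangle]) auto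
  fix s assume s: "Suc z - triangle (Suc s) = 0"
  show "pfst z + psnd z \<le> s"
  proof (rule ccontr)
    assume "\<not> ?thesis"
    then have "triangle (Suc s) \<le> triangle (pfst z + psnd z)" by (intro mono) simp
    with z s show False by linarith
  qed
qed

lemma computable_diagonal: "computable_fun (\<lambda>z. pfst z + psnd z)"
proof -
  obtain t d where t: "\<And>x. evals t [x] (triangle x)" and d: "\<And>x y. evals d [x, y] (y - x)"
    using evals_triangle evals_diff by metis
  have p: "evals (Comp d [Comp t [Comp Succ [Proj 0]], Comp Succ [Proj 1]]) [s, z]
      (Suc z - triangle (Suc s))" for s z
    by (rule evals_Comp2[OF evals_Comp1[OF evals_Comp1[OF evals_Proj evals.intros(2)] t]
          evals_Comp1[OF evals_Proj evals.intros(2)] d]) auto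
  have "evals (Mu (Comp d [Comp t [Comp Succ [Proj 0]], Comp Succ [Proj 1]])) [z]
      (LEAST s. Suc z - triangle (Suc s) = 0)" for z
  proof (rule evals_Mu[OF p])
    show "\<exists>s. Suc z - triangle (Suc s) = 0" by (rule exI[of _ z]) simp
  qed
  then show ?thesis unfolding Least_diagonal computable_fun_def by blast
qed

lemma pfst_eq: "pfst z = z - triangle (pfst z + psnd z)"
proof -
  have "z = triangle (pfst z + psnd z) + pfst z"
    using prod_decode_inverse[of z] unfolding prod_encode_def by (simp add: case_prod_beta)
  then show ?thesis by linarith
qed

lemma computable_pfst [computable]:
  assumes "computable_fun f" shows "computable_fun (\<lambda>x. pfst (f x))"
proof -
  have "computable_fun (\<lambda>z. z - triangle (pfst z + psnd z))"
    by (intro computable computable_diagonal)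
  then have "computable_fun (\<lambda>z. pfst z)" using pfst_eq by simp
  then show ?thesis by (rule computable_fun_comp) (rule assms)
qed

lemma computable_psnd [computable]:
  assumes "computable_fun f" shows "computable_fun (\<lambda>x. psnd (f x))"
proof -
  have "computable_fun (\<lambda>z. (pfst z + psnd z) - pfst z)"
    by (intro computable_diff computable_diagonal computable)
  then have "computable_fun (\<lambda>z. psnd z)" by simp
  then show ?thesis by (rule computable_fun_comp) (rule assms)
qed

text \<open>
  The step function sees the parameter \<open>e\<close>, the counter and the previous value; as a function of one number
  it receives them as a coded triple.
\<close>

lemma computable_rec_nat [computable]:
  assumes b: "computable_fun b" and n: "computable_fun n"
    and s: "computable_fun (\<lambda>t. s (pfst t) (pfst (psnd t)) (psnd (psnd t)))"
  shows "computable_fun (\<lambda>e. rec_nat (b e) (\<lambda>i a. s e i a) (n e))"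
proof -
  obtain pb where pb: "\<And>e. evals pb [e] (b e)"
    using b unfolding computable_fun_def by blast
  obtain ps where ps: "\<And>t. evals ps [t] (s (pfst t) (pfst (psnd t)) (psnd (psnd t)))"
    using s unfolding computable_fun_def by blast
  obtain pp where pp: "\<And>x y. evals pp [x, y] (prod_encode (x, y))" using evals_pair by blast
  let ?g = "Comp ps [Comp pp [Proj 2, Comp pp [Proj 0, Proj 1]]]"
  have "evals ?g [i, a, e] (s e i a)" for i a e
  proof (rule evals_Comp1)
    show "evals (Comp pp [Proj 2, Comp pp [Proj 0, Proj 1]]) [i, a, e]
        (prod_encode (e, prod_encode (i, a)))"
      by (rule evals_Comp2[OF evals_Proj evals_Comp2[OF evals_Proj evals_Proj pp] pp]) auto
    show "evals ps [prod_encode (e, prod_encode (i, a))] (s e i a)"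
      using ps[of "prod_encode (e, prod_encode (i, a))"] by simp
  qed
  then have "evals (Prec pb ?g) [n, e] (rec_nat (b e) (s e) n)" for n e
    using pb by (intro evals_Prec) auto
  from computable_fun_comp2[OF this n computable_id] show ?thesis by simp
qed

lemma computable_funpow [computable]:
  assumes "computable_fun n" and "computable_fun a" and "computable_fun f"
  shows "computable_fun (\<lambda>e. (f ^^ n e) (a e))"
proof -
  have eq: "(f ^^ n) a = rec_nat a (\<lambda>_. f) n" for n a by (induction n) auto
  show ?thesis unfolding eq by (intro computable computable_fun_comp[OF assms(3)] assms)
qed


subsection \<open>Decidable predicates\<close>

lemma decidable_iff_computable_set: "decidable P \<longleftrightarrow> computable_set {x. P x}"
  by (simp add: decidable_def computable_set_def)

lemma in_image_prod_encode: "z \<in> prod_encode ` R \<longleftrightarrow> prod_decode z \<in> R"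
  by (metis image_iff prod_decode_inverse prod_encode_inverse)

lemma decidable_comp:
  "decidable P \<Longrightarrow> computable_fun f \<Longrightarrow> decidable (\<lambda>x. P (f x))"
  unfolding decidable_def by (rule computable_fun_comp)

lemma decidable_not [computable]:
  assumes "decidable P" shows "decidable (\<lambda>x. \<not> P x)"
proof -
  have "computable_fun (\<lambda>x. 1 - of_bool (P x))"
    using assms unfolding decidable_def by (intro computable)
  moreover have "of_bool (\<not> b) = (1 - of_bool b :: nat)" for b by simp
  ultimately show ?thesis unfolding decidable_def by simp
qed

lemma decidable_conj [computable]:
  assumes "decidable P" and "decidable Q" shows "decidable (\<lambda>x. P x \<and> Q x)"
  using assms unfolding decidable_def of_bool_conj by (intro computable)

lemma decidable_disj [computable]:
  assumes "decidable P" and "decidable Q" shows "decidable (\<lambda>x. P x \<or> Q x)"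
proof -
  have "decidable (\<lambda>x. \<not> (\<not> P x \<and> \<not> Q x))" using assms by (intro computable)
  then show ?thesis by simp
qed

lemma decidable_imp [computable]:
  assumes "decidable P" and "decidable Q" shows "decidable (\<lambda>x. P x \<longrightarrow> Q x)"
proof -
  have "decidable (\<lambda>x. \<not> P x \<or> Q x)" using assms by (intro computable)
  then show ?thesis by (simp only: imp_conv_disj)
qed

lemma decidable_less [computable]:
  assumes "computable_fun f" and "computable_fun g" shows "decidable (\<lambda>x. f x < g x)"
proof -
  have "computable_fun (\<lambda>x. 1 - (1 - (g x - f x)))" using assms by (intro computable)
  moreover have "of_bool (a < b) = 1 - (1 - (b - a))" for a b :: nat by simp
  ultimately show ?thesis unfolding decidable_def by simp
qed

lemma decidable_le [computable]:
  assumes "computable_fun f" and "computable_fun g" shows "decidable (\<lambda>x. f x \<le> g x)"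
proof -
  have "decidable (\<lambda>x. \<not> g x < f x)" using assms by (intro computable)
  then show ?thesis by (simp add: not_less)
qed

lemma decidable_eq [computable]:
  assumes "computable_fun f" and "computable_fun g" shows "decidable (\<lambda>x. f x = g x)"
proof -
  have "(\<lambda>x. f x = g x) = (\<lambda>x. f x \<le> g x \<and> g x \<le> f x)" by (rule ext) linarith
  moreover have "decidable \<dots>" by (intro computable assms)
  ultimately show ?thesis by (rule ssubst[where P = decidable])
qed

lemma decidable_iff [computable]:
  assumes "decidable P" and "decidable Q" shows "decidable (\<lambda>x. P x \<longleftrightarrow> Q x)"
proof -
  have "(\<lambda>x. P x \<longleftrightarrow> Q x) = (\<lambda>x. (P x \<longrightarrow> Q x) \<and> (Q x \<longrightarrow> P x))" by (rule ext) blast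
  moreover have "decidable \<dots>" by (intro computable assms)
  ultimately show ?thesis by (rule ssubst[where P = decidable])
qed

lemma computable_of_bool [computable]: "decidable P \<Longrightarrow> computable_fun (\<lambda>x. of_bool (P x))"
  unfolding decidable_def .

text \<open>
  A recursion that tests a predicate at each stage needs the predicate on coded triples whose last
  component, the accumulator, is ignored.
\<close>

lemma decidable_forget_last:
  assumes "decidable (\<lambda>t. P (pfst t) (psnd t))"
  shows "decidable (\<lambda>t. P (pfst t) (pfst (psnd t)))"
proof -
  have "computable_fun (\<lambda>t. prod_encode (pfst t, pfst (psnd t)))" by (intro computable)
  from decidable_comp[OF assms this] show ?thesis by (simp only: prod_encode_inverse fst_conv snd_conv)
qed

lemma decidable_All_less [computable]:
  assumes b: "computable_fun b" and P: "decidable (\<lambda>t. P (pfst t) (psnd t))"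
  shows "decidable (\<lambda>e. \<forall>i<b e. P e i)"
proof -
  have *: "of_bool (\<forall>i<n. P e i) = (rec_nat 1 (\<lambda>i a. a * of_bool (P e i)) n :: nat)" for e n
  proof (induction n)
    case (Suc n)
    have "(\<forall>i<Suc n. P e i) \<longleftrightarrow> (\<forall>i<n. P e i) \<and> P e n" by (auto simp: less_Suc_eq)
    with Suc show ?case by (simp add: of_bool_conj)
  qed simp
  have "decidable (\<lambda>t. P (pfst t) (pfst (psnd t)))"
    by (rule decidable_forget_last[OF P])
  then show ?thesis unfolding decidable_def[of "\<lambda>e. \<forall>i<b e. P e i"] * by (intro computable b)
qed

lemma decidable_All_le [computable]:
  assumes "computable_fun b" and "decidable (\<lambda>t. P (pfst t) (psnd t))"
  shows "decidable (\<lambda>e. \<forall>i\<le>b e. P e i)"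
proof -
  have "decidable (\<lambda>e. \<forall>i<Suc (b e). P e i)" by (intro computable assms)
  then show ?thesis by (simp add: less_Suc_eq_le)
qed

lemma decidable_Ex_le [computable]:
  assumes "computable_fun b" and "decidable (\<lambda>t. P (pfst t) (psnd t))"
  shows "decidable (\<lambda>e. \<exists>i\<le>b e. P e i)"
proof -
  have "decidable (\<lambda>e. \<not> (\<forall>i\<le>b e. \<not> P e i))" by (intro computable assms)
  then show ?thesis by simp
qed


subsection \<open>Codes of lists and of finite sets\<close>

text \<open>
  The usual operations on lists, acting on their codes. They are total, with \<open>0\<close>, the code of
  the empty list, in the role of the default value.
\<close>

definition lhd :: "nat \<Rightarrow> nat" where "lhd w = pfst (w - 1)"
definition ltl :: "nat \<Rightarrow> nat" where "ltl w = psnd (w - 1)"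
definition lcons :: "nat \<Rightarrow> nat \<Rightarrow> nat" where "lcons x w = Suc (prod_encode (x, w))"
definition ldrop :: "nat \<Rightarrow> nat \<Rightarrow> nat" where "ldrop k w = (ltl ^^ k) w"
definition lnth :: "nat \<Rightarrow> nat \<Rightarrow> nat" where "lnth w i = lhd (ldrop i w)"

lemma computable_lhd [computable]: "computable_fun f \<Longrightarrow> computable_fun (\<lambda>x. lhd (f x))"
  unfolding lhd_def by (intro computable)

lemma computable_ltl [computable]: "computable_fun f \<Longrightarrow> computable_fun (\<lambda>x. ltl (f x))"
  unfolding ltl_def by (intro computable)

lemma computable_lcons [computable]:
  "computable_fun f \<Longrightarrow> computable_fun g \<Longrightarrow> computable_fun (\<lambda>x. lcons (f x) (g x))"
  unfolding lcons_def by (intro computable)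

lemma computable_ldrop [computable]:
  "computable_fun f \<Longrightarrow> computable_fun g \<Longrightarrow> computable_fun (\<lambda>x. ldrop (f x) (g x))"
  unfolding ldrop_def by (intro computable)

lemma computable_lnth [computable]:
  "computable_fun f \<Longrightarrow> computable_fun g \<Longrightarrow> computable_fun (\<lambda>x. lnth (f x) (g x))"
  unfolding lnth_def by (intro computable)

lemma prod_decode_0: "prod_decode 0 = (0, 0)"
  using prod_encode_inverse[of "(0, 0)"] by (simp add: prod_encode_def)

lemma list_code_simps [simp]:
  "lhd (lcons x w) = x" "ltl (lcons x w) = w" "ltl 0 = 0" "lhd 0 = 0" "0 < lcons x w"
  "lcons x w = lcons x' w' \<longleftrightarrow> x = x' \<and> w = w'"
  by (auto simp: lhd_def ltl_def lcons_def prod_decode_0)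

lemma lcons_lhd_ltl [simp]: "w \<noteq> 0 \<Longrightarrow> lcons (lhd w) (ltl w) = w"
  by (simp add: lhd_def ltl_def lcons_def)

lemma list_encode_Cons: "list_encode (x # xs) = lcons x (list_encode xs)"
  by (simp add: lcons_def)

lemma list_encode_eq_0 [simp]: "list_encode xs = 0 \<longleftrightarrow> xs = []"
  by (cases xs) auto

lemma list_decode_lcons [simp]: "list_decode (lcons x w) = x # list_decode w"
  by (simp add: lcons_def)

lemma lhd_list_encode: "xs \<noteq> [] \<Longrightarrow> lhd (list_encode xs) = hd xs"
  by (cases xs) (auto simp: list_encode_Cons simp del: list_encode.simps)

lemma ltl_list_encode: "ltl (list_encode xs) = list_encode (tl xs)"
  by (cases xs) (auto simp: list_encode_Cons simp del: list_encode.simps(2))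

lemma ldrop_list_encode: "ldrop k (list_encode xs) = list_encode (drop k xs)"
  unfolding ldrop_def by (induction k) (auto simp: ltl_list_encode drop_Suc tl_drop)

lemma lnth_list_encode: "lnth (list_encode xs) i = (if i < length xs then xs ! i else 0)"
  by (simp add: lnth_def ldrop_list_encode lhd_list_encode hd_drop_conv_nth)

lemma ldrop_0 [simp]: "ldrop 0 w = w"
  by (simp add: ldrop_def)

lemma ldrop_ldrop: "ldrop j (ldrop k w) = ldrop (j + k) w"
  by (simp add: ldrop_def funpow_add)

lemma length_le_list_encode: "length xs \<le> list_encode xs"
proof (induction xs)
  case (Cons x xs)
  then show ?case using le_prod_encode_2[of "list_encode xs" x] by simp
qed simp

lemma ldrop_le: "ldrop k w \<le> w"
proof -
  have "ltl w \<le> w" for w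
    using le_prod_encode_2[of "psnd (w - 1)" "pfst (w - 1)"] by (simp add: ltl_def)
  then show ?thesis unfolding ldrop_def by (induction k) (auto intro: le_trans)
qed

lemma computable_mod_2 [computable]:
  assumes "computable_fun f" shows "computable_fun (\<lambda>x. f x mod 2)"
proof -
  have "n mod 2 = rec_nat 0 (\<lambda>_ a. 1 - a) n" for n :: nat
    by (induction n) (auto simp: mod_Suc simp flip: One_nat_def)
  then show ?thesis by (simp only:) (intro computable assms)
qed

text \<open>Halving \<open>n\<close> counts the odd numbers below \<open>n\<close>.\<close>

lemma computable_div_2 [computable]:
  assumes "computable_fun f" shows "computable_fun (\<lambda>x. f x div 2)"
proof -
  have "n div 2 = rec_nat 0 (\<lambda>i a. a + i mod 2) n" for n :: nat
    by (induction n) (auto simp flip: One_nat_def, presburger)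
  then show ?thesis by (simp only:) (intro computable assms)
qed

lemma decidable_even [computable]:
  assumes "computable_fun f" shows "decidable (\<lambda>x. even (f x))"
  unfolding even_iff_mod_2_eq_zero by (intro computable assms)

lemma decidable_set_decode [computable]:
  assumes "computable_fun f" and "computable_fun g"
  shows "decidable (\<lambda>x. f x \<in> set_decode (g x))"
proof -
  have eq: "x div 2 ^ n = ((\<lambda>y. y div 2) ^^ n) x" for x n :: nat
  proof (induction n)
    case (Suc n)
    have "x div 2 ^ Suc n = x div 2 ^ n div 2" by (simp only: power_Suc2 div_mult2_eq)
    with Suc show ?case by simp
  qed simp
  show ?thesis unfolding set_decode_def mem_Collect_eq eq by (intro computable assms)
qed

lemma set_decode_less: "t \<in> set_decode x \<Longrightarrow> t < x"
proof (rule ccontr)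
  assume t: "t \<in> set_decode x" and "\<not> t < x"
  then have "x < 2 ^ t" using less_exp[of t] by linarith
  with t show False by (simp add: set_decode_def)
qed

lemma computable_card_bounded [computable]:
  assumes "computable_fun b" and "decidable (\<lambda>t. P (pfst t) (psnd t))"
  shows "computable_fun (\<lambda>e. card {i. i < b e \<and> P e i})"
proof -
  have eq: "card {i. i < n \<and> P e i} = rec_nat 0 (\<lambda>i a. a + of_bool (P e i)) n" for e n
  proof (induction n)
    case (Suc n)
    have "{i. i < Suc n \<and> P e i} = (if P e n then insert n {i. i < n \<and> P e i} else {i. i < n \<and> P e i})"
      by (auto simp: less_Suc_eq)
    with Suc show ?case by auto
  qed simp
  show ?thesis unfolding eq by (intro computable assms decidable_forget_last[OF assms(2)])
qed


section \<open>Certificates for computations\<close>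

primrec code :: "recf \<Rightarrow> nat" where
  "code Zero = prod_encode (0, 0)"
| "code Succ = prod_encode (1, 0)"
| "code (Proj i) = prod_encode (2, i)"
| "code (Comp f gs) = prod_encode (3, prod_encode (code f, list_encode (map code gs)))"
| "code (Prec f g) = prod_encode (4, prod_encode (code f, code g))"
| "code (Mu f) = prod_encode (5, code f)"

text \<open>
  A fact records that a program, given by its code, has a value on a list of arguments.
\<close>

definition fact :: "nat \<Rightarrow> nat \<Rightarrow> nat \<Rightarrow> nat" where
  "fact q xs y = prod_encode (q, prod_encode (xs, y))"
abbreviation prog :: "nat \<Rightarrow> nat" where "prog t \<equiv> pfst t"
abbreviation args :: "nat \<Rightarrow> nat" where "args t \<equiv> pfst (psnd t)"
abbreviation res :: "nat \<Rightarrow> nat" where "res t \<equiv> psnd (psnd t)"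

lemma fact_simps [simp]: "prog (fact q xs y) = q" "args (fact q xs y) = xs" "res (fact q xs y) = y"
  by (auto simp: fact_def)

text \<open>
  One application of a rule of \<open>evals\<close> with premises in \<open>F\<close>, read on codes; the value of \<open>pfst q\<close> selects
  the constructor of the program. For a composition, \<open>s\<close> is the premise for the outer function,
  so \<open>args s\<close> lists the values of the inner ones. There the variable \<open>k\<close> ranges over all positions of both lists, as
  a list is never longer than its code. Premises that mention an unknown value are sought by
  quantifying over the members of \<open>F\<close>, which keeps the predicate decidable for finite \<open>F\<close>.
\<close>

definition derives :: "nat set \<Rightarrow> nat \<Rightarrow> nat \<Rightarrow> nat \<Rightarrow> bool" where
  "derives F q xs y \<longleftrightarrow>
     pfst q = 0 \<and> y = 0 \<or>
     pfst q = 1 \<and> xs = lcons (lhd xs) 0 \<and> y = Suc (lhd xs) \<or>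
     pfst q = 2 \<and> ldrop (psnd q) xs \<noteq> 0 \<and> y = lnth xs (psnd q) \<or>
     pfst q = 3 \<and> (\<exists>s\<in>F. prog s = pfst (psnd q) \<and> res s = y \<and>
       (\<forall>k\<le>psnd (psnd q) + args s.
          (ldrop k (psnd (psnd q)) = 0 \<longleftrightarrow> ldrop k (args s) = 0) \<and>
          (ldrop k (psnd (psnd q)) \<noteq> 0 \<longrightarrow> fact (lnth (psnd (psnd q)) k) xs (lnth (args s) k) \<in> F))) \<or>
     pfst q = 4 \<and> xs \<noteq> 0 \<and> lhd xs = 0 \<and> fact (pfst (psnd q)) (ltl xs) y \<in> F \<or>
     pfst q = 4 \<and> lhd xs \<noteq> 0 \<and> (\<exists>s\<in>F. prog s = q \<and> args s = lcons (lhd xs - 1) (ltl xs) \<and>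
       fact (psnd (psnd q)) (lcons (lhd xs - 1) (lcons (res s) (ltl xs))) y \<in> F) \<or>
     pfst q = 5 \<and> fact (psnd q) (lcons y xs) 0 \<in> F \<and>
       (\<forall>m<y. \<exists>s\<in>F. prog s = psnd q \<and> args s = lcons m xs \<and> res s \<noteq> 0)"

lemma derives_mono: "derives F q xs y \<Longrightarrow> F \<subseteq> G \<Longrightarrow> derives G q xs y"
  unfolding derives_def by (elim disj_forward; blast)

definition above :: "nat \<Rightarrow> nat \<Rightarrow> nat set" where
  "above w i = {lnth w j | j. i < j \<and> j \<le> w}"

text \<open>
  In a certificate each entry follows from entries further down the list, which rules out
  circular justifications. Positions beyond the end of the list hold the default \<open>0\<close>, which is the true fact that the
  program \<open>Zero\<close> has the value \<open>0\<close> on the empty list, so the length of the list need not be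
  computed.
\<close>

definition certificate :: "nat \<Rightarrow> bool" where
  "certificate w \<longleftrightarrow>
     (\<forall>i\<le>w. derives (above w i) (prog (lnth w i)) (args (lnth w i)) (res (lnth w i)))"

definition accepts :: "nat \<Rightarrow> nat \<Rightarrow> nat \<Rightarrow> bool" where
  "accepts w q x \<longleftrightarrow> certificate w \<and> (\<exists>i\<le>w. lnth w i = fact q (lcons x 0) 1)"

lemma decidable_accepts [computable]:
  assumes "computable_fun f" and "computable_fun g" and "computable_fun h"
  shows "decidable (\<lambda>e. accepts (f e) (g e) (h e))"
proof -
  have bex: "(\<exists>s\<in>above w i. P s) \<longleftrightarrow> (\<exists>j\<le>w. i < j \<and> P (lnth w j))" for w i P
    unfolding above_def by blast
  have mem: "s \<in> above w i \<longleftrightarrow> (\<exists>j\<le>w. i < j \<and> lnth w j = s)" for w i s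
    unfolding above_def by blast
  have "decidable (\<lambda>e. derives (above (pfst e) (psnd e)) (prog (lnth (pfst e) (psnd e)))
      (args (lnth (pfst e) (psnd e))) (res (lnth (pfst e) (psnd e))))"
    unfolding derives_def bex mem fact_def by (intro computable)
  then have "decidable (\<lambda>e. certificate e)"
    unfolding certificate_def by (intro computable)
  note certificate = decidable_comp[OF this]
  have "decidable (\<lambda>e. accepts (pfst e) (pfst (psnd e)) (psnd (psnd e)))"
    unfolding accepts_def fact_def by (intro computable certificate)
  then have "decidable (\<lambda>e. accepts (pfst (prod_encode (f e, prod_encode (g e, h e))))
      (pfst (psnd (prod_encode (f e, prod_encode (g e, h e)))))
      (psnd (psnd (prod_encode (f e, prod_encode (g e, h e))))))"
    by (rule decidable_comp) (intro computable assms)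
  then show ?thesis by simp
qed


subsection \<open>Soundness\<close>

lemma ldrop_eq_0_iff: "ldrop k w = 0 \<longleftrightarrow> length (list_decode w) \<le> k"
  using ldrop_list_encode[of k "list_decode w"] by simp

lemma lnth_list_decode: "i < length (list_decode w) \<Longrightarrow> lnth w i = list_decode w ! i"
  using lnth_list_encode[of "list_decode w" i] by simp

lemma list_decode_0_iff: "w = 0 \<longleftrightarrow> list_decode w = []"
  by (metis list_decode_inverse list_encode_eq_0)

lemma list_decode_conv: "w \<noteq> 0 \<Longrightarrow> list_decode w = lhd w # list_decode (ltl w)"
  by (metis lcons_lhd_ltl list_decode_lcons)

text \<open>
  The clauses of \<open>derives\<close> mirror the rules of \<open>evals\<close>; the constructor of \<open>p\<close> determines the only clause that
  can apply to \<open>code p\<close>.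
\<close>

lemma derives_sound:
  assumes d: "derives F (code p) xs y"
    and F: "\<And>t p. t \<in> F \<Longrightarrow> code p = prog t \<Longrightarrow> evals p (list_decode (args t)) (res t)"
  shows "evals p (list_decode xs) y"
proof -
  have F': "evals p (list_decode us) v" if "fact (code p) us v \<in> F" for p us v
    using F[OF that, of p] by simp
  show ?thesis
  proof (cases p)
    case Zero
    with d have "y = 0" by (auto simp: derives_def)
    then show ?thesis using Zero by (auto intro: evals.intros)
  next
    case Succ
    with d have xs: "xs = lcons (lhd xs) 0" "y = Suc (lhd xs)" by (auto simp: derives_def)
    then have "list_decode xs = [lhd xs]" by (metis list_decode_lcons list_decode.simps(1))
    then show ?thesis using Succ xs(2) evals.intros(2) by metis
  next
    case (Proj i)
    with d have "\<not> length (list_decode xs) \<le> i" "y = lnth xs i"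
      by (auto simp: derives_def ldrop_eq_0_iff)
    then show ?thesis using Proj by (auto intro!: evals_Proj simp: lnth_list_decode)
  next
    case (Comp f gs)
    with d obtain s where s: "s \<in> F" "prog s = code f" "res s = y" and
      k: "\<And>k. k \<le> list_encode (map code gs) + args s \<Longrightarrow>
            (length gs \<le> k \<longleftrightarrow> length (list_decode (args s)) \<le> k) \<and>
            (k < length gs \<longrightarrow> fact (lnth (list_encode (map code gs)) k) xs (lnth (args s) k) \<in> F)"
      by (auto simp: derives_def ldrop_eq_0_iff not_le)
    define ys where "ys = list_decode (args s)"
    have le: "length gs \<le> list_encode (map code gs)" "length ys \<le> args s"
      using length_le_list_encode[of "map code gs"] length_le_list_encode[of ys]
      by (auto simp: ys_def)
    have len: "length gs = length ys"
      using k[of "length gs"] k[of "length ys"] le by (simp add: ys_def)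
    have "list_all2 (\<lambda>g y. evals g (list_decode xs) y) gs ys"
      unfolding list_all2_conv_all_nth
    proof (intro conjI allI impI len)
      fix i assume i: "i < length gs"
      then have "fact (lnth (list_encode (map code gs)) i) xs (lnth (args s) i) \<in> F"
        using k[of i] le by simp
      then have "fact (code (gs ! i)) xs (ys ! i) \<in> F"
        using i len by (simp add: lnth_list_encode lnth_list_decode ys_def)
      then show "evals (gs ! i) (list_decode xs) (ys ! i)" by (rule F')
    qed
    moreover have "evals f ys y" using F[OF s(1)] s by (simp add: ys_def)
    ultimately show ?thesis using Comp by (auto intro: evals.intros)
  next
    case (Prec f g)
    show ?thesis
    proof (cases "lhd xs = 0")
      case True
      with Prec d have "xs \<noteq> 0" "fact (code f) (ltl xs) y \<in> F" by (auto simp: derives_def)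
      then show ?thesis using Prec True F' list_decode_conv[of xs] by (auto intro: evals.intros)
    next
      case False
      with Prec d obtain s where s: "s \<in> F" "prog s = code p" "args s = lcons (lhd xs - 1) (ltl xs)"
        "fact (code g) (lcons (lhd xs - 1) (lcons (res s) (ltl xs))) y \<in> F"
        by (auto simp: derives_def)
      from False have "xs \<noteq> 0" by (metis list_code_simps(4))
      moreover have "evals p ((lhd xs - 1) # list_decode (ltl xs)) (res s)"
        using F[OF s(1), of p] s by simp
      moreover have "evals g ((lhd xs - 1) # res s # list_decode (ltl xs)) y"
        using F'[OF s(4)] by simp
      ultimately have "evals p (Suc (lhd xs - 1) # list_decode (ltl xs)) y"
        using Prec evals.intros(6) by blast
      then show ?thesis using False \<open>xs \<noteq> 0\<close> list_decode_conv by simp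
    qed
  next
    case (Mu f)
    with d have 0: "fact (code f) (lcons y xs) 0 \<in> F"
      and m: "\<And>m. m < y \<Longrightarrow> \<exists>s\<in>F. prog s = code f \<and> args s = lcons m xs \<and> res s \<noteq> 0"
      by (auto simp: derives_def)
    have "\<exists>k. evals f (m # list_decode xs) (Suc k)" if "m < y" for m
    proof -
      obtain s where s: "s \<in> F" "prog s = code f" "args s = lcons m xs" "res s \<noteq> 0"
        using m \<open>m < y\<close> by blast
      then have "evals f (m # list_decode xs) (res s)" using F[OF s(1), of f] by simp
      then show ?thesis using s(4) by (metis not0_implies_Suc)
    qed
    then show ?thesis using Mu F'[OF 0] by (auto intro: evals.intros)
  qed
qed

lemma certificate_sound:
  assumes "certificate w" and "i \<le> w" and "code p = prog (lnth w i)"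
  shows "evals p (list_decode (args (lnth w i))) (res (lnth w i))"
  using assms(2,3)
proof (induction "w - i" arbitrary: i p rule: less_induct)
  case less
  have "derives (above w i) (code p) (args (lnth w i)) (res (lnth w i))"
    using assms(1) less.prems by (auto simp: certificate_def)
  then show ?case
  proof (rule derives_sound)
    fix t p assume "t \<in> above w i" and p: "code p = prog t"
    then obtain j where "t = lnth w j" "i < j" "j \<le> w" by (auto simp: above_def)
    then show "evals p (list_decode (args t)) (res t)"
      using less.hyps[of j p] p by simp
  qed
qed


subsection \<open>Completeness\<close>

text \<open>
  Derivations are certificates as lists. In this form they can be concatenated, which combines
  the derivations of finitely many premises.
\<close>

definition derivation :: "nat list \<Rightarrow> bool" where
  "derivation ts \<longleftrightarrow> (\<forall>i<length ts.
     derives (set (drop (Suc i) ts)) (prog (ts ! i)) (args (ts ! i)) (res (ts ! i)))"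

definition derivable :: "nat \<Rightarrow> bool" where
  "derivable t \<longleftrightarrow> (\<exists>ts. derivation ts \<and> t \<in> set ts)"

lemma derivation_Cons:
  "derivation (t # ts) \<longleftrightarrow> derives (set ts) (prog t) (args t) (res t) \<and> derivation ts"
  unfolding derivation_def by (auto simp: less_Suc_eq_0_disj)

lemma derivation_append: "derivation ts \<Longrightarrow> derivation us \<Longrightarrow> derivation (ts @ us)"
proof (induction ts)
  case (Cons t ts)
  then show ?case by (auto simp: derivation_Cons intro: derives_mono)
qed simp

lemma finite_derivable:
  assumes "finite F" and "\<And>t. t \<in> F \<Longrightarrow> derivable t"
  shows "\<exists>ts. derivation ts \<and> F \<subseteq> set ts"
  using assms
proof (induction F rule: finite_induct)
  case empty
  show ?case by (rule exI[of _ "[]"]) (simp add: derivation_def)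
next
  case (insert t F)
  then obtain ts where "derivation ts" "F \<subseteq> set ts" by blast
  moreover obtain us where "derivation us" "t \<in> set us"
    using insert.prems[of t] unfolding derivable_def by blast
  ultimately show ?case by (intro exI[of _ "ts @ us"]) (auto intro: derivation_append)
qed

lemma derivable_step:
  assumes "finite F" and "\<And>t. t \<in> F \<Longrightarrow> derivable t" and "derives F q xs y"
  shows "derivable (fact q xs y)"
proof -
  obtain ts where ts: "derivation ts" "F \<subseteq> set ts" using finite_derivable[OF assms(1,2)] by blast
  then have "derivation (fact q xs y # ts)"
    using derives_mono[OF assms(3)] by (simp add: derivation_Cons)
  then show ?thesis unfolding derivable_def by (metis list.set_intros(1))
qed

lemma evals_derivable: "evals p xs y \<Longrightarrow> derivable (fact (code p) (list_encode xs) y)"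
proof (induction rule: evals.induct)
  case (1 xs)
  show ?case by (rule derivable_step[of "{}"]) (auto simp: derives_def)
next
  case (2 x)
  show ?case by (rule derivable_step[of "{}"]) (auto simp: derives_def list_encode_Cons simp del: list_encode.simps(2))
next
  case (3 i xs)
  show ?case
    by (rule derivable_step[of "{}"]) (use 3 in \<open>auto simp: derives_def ldrop_list_encode lnth_list_encode\<close>)
next
  case (4 xs gs ys f z)
  have len: "length gs = length ys" using 4(1) by (simp add: list_all2_conv_all_nth)
  let ?F = "insert (fact (code f) (list_encode ys) z)
    ((\<lambda>i. fact (code (gs ! i)) (list_encode xs) (ys ! i)) ` {..<length gs})"
  show ?case
  proof (rule derivable_step[of ?F])
    show "derivable t" if "t \<in> ?F" for t
      using that 4 by (auto simp: list_all2_conv_all_nth)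
    show "derives ?F (code (Comp f gs)) (list_encode xs) z"
      unfolding derives_def
      by (simp add: ldrop_list_encode lnth_list_encode len)
  qed simp
next
  case (5 f xs y g)
  show ?case
    by (rule derivable_step[of "{fact (code f) (list_encode xs) y}"])
      (use 5 in \<open>auto simp: derives_def list_encode_Cons simp del: list_encode.simps(2)\<close>)
next
  case (6 f g n xs y z)
  show ?case
    by (rule derivable_step[of "{fact (code (Prec f g)) (list_encode (n # xs)) y,
          fact (code g) (list_encode (n # y # xs)) z}"])
      (use 6 in \<open>auto simp: derives_def list_encode_Cons simp del: list_encode.simps(2)\<close>)
next
  case (7 f n xs)
  then obtain k where k: "\<And>m. m < n \<Longrightarrow> derivable (fact (code f) (list_encode (m # xs)) (Suc (k m)))"
    by metis
  let ?F = "insert (fact (code f) (list_encode (n # xs)) 0)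
    ((\<lambda>m. fact (code f) (list_encode (m # xs)) (Suc (k m))) ` {..<n})"
  show ?case
  proof (rule derivable_step[of ?F])
    show "derivable t" if "t \<in> ?F" for t using that 7 k by auto
    show "derives ?F (code (Mu f)) (list_encode xs) n"
      unfolding derives_def by (simp add: list_encode_Cons del: list_encode.simps(2))
  qed simp
qed

lemma derivable_certificate:
  assumes "derivable t" shows "\<exists>w. certificate w \<and> (\<exists>i\<le>w. lnth w i = t)"
proof -
  obtain ts i where ts: "derivation ts" and i: "i < length ts" "ts ! i = t"
    using assms unfolding derivable_def by (metis in_set_conv_nth)
  define w where "w = list_encode ts"
  have len: "length ts \<le> w" unfolding w_def by (rule length_le_list_encode)
  have "certificate w"
    unfolding certificate_def
  proof (intro allI impI)
    fix j assume "j \<le> w"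
    show "derives (above w j) (prog (lnth w j)) (args (lnth w j)) (res (lnth w j))"
    proof (cases "j < length ts")
      case True
      have "set (drop (Suc j) ts) \<subseteq> above w j"
      proof
        fix t assume "t \<in> set (drop (Suc j) ts)"
        then obtain k where k: "k < length ts - Suc j" "t = ts ! (Suc j + k)"
          by (auto simp: in_set_conv_nth)
        then have "t = lnth w (Suc j + k)" using less_diff_conv[of k "length ts" "Suc j"] by (simp add: w_def lnth_list_encode add.commute)
        moreover have "Suc j + k \<le> w" using k len by simp
        ultimately show "t \<in> above w j" unfolding above_def by force
      qed
      then show ?thesis using ts True derives_mono by (auto simp: derivation_def w_def lnth_list_encode)
    next
      case False
      then show ?thesis by (simp add: w_def lnth_list_encode derives_def prod_decode_0)
    qed
  qed
  moreover have "lnth w i = t" "i \<le> w" using i len by (auto simp: w_def lnth_list_encode)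
  ultimately show ?thesis by blast
qed


subsection \<open>A universal enumeration of the decidable sets\<close>

inductive_cases evals_inverts:
  "evals Zero xs y" "evals Succ [x] y" "evals (Proj i) xs y" "evals (Comp f gs) xs y"
  "evals (Prec f g) (0 # xs) y" "evals (Prec f g) (Suc n # xs) y" "evals (Mu f) xs y"

lemma MuD:
  assumes "evals (Mu f) xs y"
  shows "evals f (y # xs) 0 \<and> (\<forall>m<y. \<exists>k. evals f (m # xs) (Suc k))"
  using assms by (rule evals_inverts(7)) (rule conjI)

text \<open>
  Determinism excludes that a program with value \<open>0\<close> on some argument also has a certificate for
  the value \<open>1\<close>.
\<close>

lemma evals_deterministic: "evals p xs y \<Longrightarrow> evals p xs y' \<Longrightarrow> y = y'"
proof (induction arbitrary: y' rule: evals.induct)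
  case (4 xs gs ys f z)
  from 4(4) obtain ys' where ys': "list_all2 (\<lambda>g. evals g xs) gs ys'" "evals f ys' y'"
    by (blast elim: evals_inverts)
  have "ys = ys'"
    using 4(1) ys'(1) by (auto simp: list_all2_conv_all_nth intro: nth_equalityI)
  then show ?case using 4 ys'(2) by blast
next
  case (7 f n xs)
  note MuD[OF \<open>evals (Mu f) xs y'\<close>]
  then show ?case using 7 by (metis nat.distinct(1) nat_neq_iff)
qed (blast elim: evals_inverts)+

lemma accepts_iff: "(\<exists>w. accepts w (code p) x) \<longleftrightarrow> evals p [x] 1"
proof
  assume "\<exists>w. accepts w (code p) x"
  then show "evals p [x] 1"
    using certificate_sound[of _ _ p] unfolding accepts_def by fastforce
next
  assume "evals p [x] 1"
  then have "derivable (fact (code p) (lcons x 0) 1)"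
    using evals_derivable[of p "[x]" 1] by (simp add: lcons_def)
  then show "\<exists>w. accepts w (code p) x"
    using derivable_certificate unfolding accepts_def by blast
qed

lemma computable_set_accepts:
  assumes "computable_set A" shows "\<exists>q. A = {x. \<exists>w. accepts w q x}"
proof -
  obtain p where p: "\<And>x. evals p [x] (of_bool (x \<in> A))"
    using assms by (auto simp: computable_set_def computable_fun_def)
  have "evals p [x] 1 \<longleftrightarrow> x \<in> A" for x
    using p[of x] evals_deterministic[OF p[of x], of 1] by (cases "x \<in> A") (simp, simp, blast)
  then show ?thesis using accepts_iff[of p] by (intro exI[of _ "code p"]) auto
qed


section \<open>Countable ordinals\<close>

lemma cord_bounded:
  fixes C :: "cord set"
  assumes "countable C" shows "\<exists>\<beta>. \<forall>\<alpha>\<in>C. \<alpha> < \<beta>"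
proof (rule ccontr)
  assume "\<not> ?thesis"
  then have "UNIV = (\<Union>\<alpha>\<in>C. insert \<alpha> {\<beta>. \<beta> < \<alpha>})" by (auto simp: not_less) (metis antisym_conv1)
  moreover have "countable (\<Union>\<alpha>\<in>C. insert \<alpha> {\<beta>. \<beta> < \<alpha>})"
    using assms countable_below_cord by (intro countable_UN countable_insert)
  ultimately show False using not_countable_UNIV_cord by simp
qed

text \<open>
  The rank of \<open>x\<close> is the least strict upper bound of the ranks of its predecessors. It exists
  because the range of the rank function is countable.
\<close>

lemma rank_function:
  fixes r :: "(nat \<times> nat) set"
  assumes "wf r"
  obtains f :: "nat \<Rightarrow> cord"
  where "\<And>x. f x = (LEAST \<beta>. \<forall>y. (y, x) \<in> r \<longrightarrow> f y < \<beta>)"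
    and "\<And>x y. (y, x) \<in> r \<Longrightarrow> f y < f x"
proof
  let ?F = "\<lambda>f x. LEAST \<beta> :: cord. \<forall>y. (y, x) \<in> r \<longrightarrow> f y < \<beta>"
  define f where "f = wfrec r ?F"
  show f: "f x = (LEAST \<beta>. \<forall>y. (y, x) \<in> r \<longrightarrow> f y < \<beta>)" for x
  proof -
    have "f x = ?F (cut f r x) x" unfolding f_def by (rule wfrec[OF assms])
    also have "\<dots> = ?F f x" by (intro arg_cong[of _ _ Least] ext) (simp add: cut_def)
    finally show ?thesis .
  qed
  show "f y < f x" if "(y, x) \<in> r" for x y
  proof -
    obtain \<beta> where "\<forall>\<alpha>\<in>range f. \<alpha> < \<beta>" using cord_bounded[of "range f"] by auto
    then have "\<exists>\<beta>. \<forall>y. (y, x) \<in> r \<longrightarrow> f y < \<beta>" by auto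
    from LeastI_ex[OF this] show ?thesis using that unfolding f[of x] by blast
  qed
qed

text \<open>
  The rank function of a well-order is injective by totality, and its range is an initial segment: an
  \<open>r\<close>-least element of rank at least \<open>\<beta>\<close> has rank exactly \<open>\<beta>\<close>.
\<close>

lemma wellorder_iso_cord:
  fixes r :: "(nat \<times> nat) set"
  assumes wf: "wf r" and sub: "r \<subseteq> D \<times> D"
    and total: "\<And>x y. x \<in> D \<Longrightarrow> y \<in> D \<Longrightarrow> x = y \<or> (x, y) \<in> r \<or> (y, x) \<in> r"
  obtains \<alpha> f where "bij_betw f D {\<beta>. \<beta> < (\<alpha> :: cord)}"
    and "\<And>x y. x \<in> D \<Longrightarrow> y \<in> D \<Longrightarrow> (x, y) \<in> r \<longleftrightarrow> f x < f y"
proof -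
  obtain f where f: "\<And>x. f x = (LEAST \<beta> :: cord. \<forall>y. (y, x) \<in> r \<longrightarrow> f y < \<beta>)"
    and mono: "\<And>x y. (y, x) \<in> r \<Longrightarrow> f y < f x"
    using rank_function[OF wf] by blast
  have iff: "(x, y) \<in> r \<longleftrightarrow> f x < f y" if "x \<in> D" "y \<in> D" for x y
    using total[OF that] mono by (metis less_asym less_irrefl)
  define \<alpha> where "\<alpha> = (LEAST \<alpha>. \<forall>x\<in>D. f x < \<alpha>)"
  have "\<exists>\<alpha>. \<forall>x\<in>D. f x < \<alpha>" using cord_bounded[of "f ` D"] by auto
  from LeastI_ex[OF this] have below: "f x < \<alpha>" if "x \<in> D" for x
    using that by (auto simp: \<alpha>_def)
  have "inj_on f D"
    using total mono by (intro inj_onI) (metis less_irrefl)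
  moreover have "f ` D = {\<beta>. \<beta> < \<alpha>}"
  proof (intro equalityI subsetI)
    fix \<beta> assume "\<beta> \<in> {\<beta>. \<beta> < \<alpha>}"
    then have "\<not> (\<forall>x\<in>D. f x < \<beta>)" unfolding \<alpha>_def using not_less_Least by blast
    then have "{x \<in> D. \<beta> \<le> f x} \<noteq> {}" by (auto simp: not_less)
    then obtain x where x: "x \<in> D" "\<beta> \<le> f x" and min: "\<And>y. (y, x) \<in> r \<Longrightarrow> y \<in> D \<Longrightarrow> f y < \<beta>"
      using wfE_min[OF wf, of _ "{x \<in> D. \<beta> \<le> f x}"] by (metis (mono_tags, lifting) all_not_in_conv mem_Collect_eq not_less)
    have "\<forall>y. (y, x) \<in> r \<longrightarrow> f y < \<beta>" using min sub by blast
    then have "f x \<le> \<beta>" unfolding f[of x] by (rule Least_le)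
    with x show "\<beta> \<in> f ` D" by force
  qed (use below in auto)
  ultimately show ?thesis using iff by (intro that[of f \<alpha>]) (auto simp: bij_betw_def)
qed

text \<open>
  If \<open>\<alpha> < \<beta>\<close>, the two enumerations would combine to an increasing map from the ordinals below \<open>\<beta>\<close> into those
  below \<open>\<alpha>\<close>. Increasing maps between ordinals satisfy \<open>\<gamma> \<le> h \<gamma>\<close>, which fails for \<open>\<gamma> = \<alpha>\<close>.
\<close>

lemma order_type_unique:
  assumes f: "bij_betw f D {\<gamma>. \<gamma> < (\<alpha> :: cord)}" and g: "bij_betw g D {\<gamma>. \<gamma> < \<beta>}"
    and fg: "\<And>x y. x \<in> D \<Longrightarrow> y \<in> D \<Longrightarrow> f x < f y \<longleftrightarrow> g x < g y"
  shows "\<beta> \<le> \<alpha>"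
proof (rule ccontr)
  assume "\<not> \<beta> \<le> \<alpha>"
  then have "\<alpha> < \<beta>" by simp
  define h where "h \<gamma> = f (inv_into D g \<gamma>)" for \<gamma>
  have inv: "inv_into D g \<gamma> \<in> D" "g (inv_into D g \<gamma>) = \<gamma>" if "\<gamma> < \<beta>" for \<gamma>
    using that g by (auto simp: bij_betw_def intro: inv_into_into f_inv_into_f)
  have less: "h \<gamma> < \<alpha>" if "\<gamma> < \<beta>" for \<gamma>
    using inv(1)[OF that] f by (auto simp: h_def bij_betw_def)
  have mono: "h \<gamma> < h \<delta>" if "\<gamma> < \<delta>" "\<delta> < \<beta>" for \<gamma> \<delta>
    using that inv[of \<gamma>] inv[of \<delta>] fg by (auto simp: h_def)
  have "\<gamma> < \<beta> \<longrightarrow> \<gamma> \<le> h \<gamma>" for \<gamma>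
  proof (induction \<gamma> rule: less_induct)
    case (less \<gamma>)
    then show ?case using mono[of "h \<gamma>" \<gamma>] by (metis leD less_trans not_le)
  qed
  then show False using less[OF \<open>\<alpha> < \<beta>\<close>] \<open>\<alpha> < \<beta>\<close> by (metis leD)
qed


subsection \<open>Computable ordinals\<close>

lemma countable_computable_sets: "countable {A. computable_set A}"
proof (rule countable_subset)
  show "{A. computable_set A} \<subseteq> range (\<lambda>q. {x. \<exists>w. accepts w q x})"
    by (auto dest!: computable_set_accepts)
qed simp

text \<open>
  There are only countably many pairs of computable sets, and such a pair presents at most one
  ordinal. So some countable ordinal is not computable, and the least one is as claimed.
\<close>

lemma not_computable_ordinal_omega1_CK: "\<not> computable_ordinal omega1_CK"
proof -
  have "\<exists>\<alpha>. \<not> computable_ordinal \<alpha>"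
  proof (rule ccontr)
    assume "\<not> ?thesis"
    then have "\<forall>\<alpha>. computable_ordinal \<alpha>" by blast
    then obtain D R f where comp: "\<And>\<alpha>. computable_set (D \<alpha>)" "\<And>\<alpha>. computable_set (prod_encode ` R \<alpha>)"
      and bij: "\<And>\<alpha>. bij_betw (f \<alpha>) (D \<alpha>) {\<beta>. \<beta> < (\<alpha> :: cord)}"
      and iff: "\<And>\<alpha> x y. x \<in> D \<alpha> \<Longrightarrow> y \<in> D \<alpha> \<Longrightarrow> (x, y) \<in> R \<alpha> \<longleftrightarrow> f \<alpha> x < f \<alpha> y"
      unfolding computable_ordinal_def by metis
    let ?c = "\<lambda>\<alpha>. (D \<alpha>, prod_encode ` R \<alpha>)"
    have le: "\<beta> \<le> \<alpha>" if eq: "?c \<alpha> = ?c \<beta>" for \<alpha> \<beta>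
    proof (rule order_type_unique)
      show "bij_betw (f \<alpha>) (D \<alpha>) {\<gamma>. \<gamma> < \<alpha>}" by (rule bij)
      show "bij_betw (f \<beta>) (D \<alpha>) {\<gamma>. \<gamma> < \<beta>}" using bij[of \<beta>] eq by simp
      have "R \<alpha> = R \<beta>" using eq inj_image_eq_iff[OF inj_prod_encode] by blast
      then show "f \<alpha> x < f \<alpha> y \<longleftrightarrow> f \<beta> x < f \<beta> y" if "x \<in> D \<alpha>" "y \<in> D \<alpha>" for x y
        using that iff[of x \<alpha> y] iff[of x \<beta> y] eq by simp
    qed
    have "inj ?c"
    proof (rule injI)
      fix \<alpha> \<beta> assume "?c \<alpha> = ?c \<beta>"
      then show "\<alpha> = \<beta>" using le[of \<alpha> \<beta>] le[of \<beta> \<alpha>] by (metis order.antisym)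
    qed
    moreover have "countable (range ?c)"
      by (rule countable_subset[of _ "{A. computable_set A} \<times> {A. computable_set A}"])
        (use comp countable_computable_sets in auto)
    ultimately show False using not_countable_UNIV_cord countable_image_inj_on by blast
  qed
  then show ?thesis unfolding omega1_CK_def by (rule LeastI_ex)
qed

text \<open>
  In a computable presentation of \<open>\<alpha>\<close> the elements below a fixed point \<open>d\<close> form a computable set, which presents
  the ordinal \<open>\<beta>\<close> that corresponds to \<open>d\<close>.
\<close>

lemma computable_ordinal_downward:
  assumes "computable_ordinal \<alpha>" and "\<beta> < \<alpha>" shows "computable_ordinal \<beta>"
proof -
  obtain D R f where D: "computable_set D" and R: "computable_set (prod_encode ` R)"
    and sub: "R \<subseteq> D \<times> D" and bij: "bij_betw f D {\<gamma>. \<gamma> < \<alpha>}"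
    and iff: "\<And>x y. x \<in> D \<Longrightarrow> y \<in> D \<Longrightarrow> (x, y) \<in> R \<longleftrightarrow> f x < f y"
    using assms(1) unfolding computable_ordinal_def by blast
  have "\<beta> \<in> f ` D" using bij assms(2) by (simp add: bij_betw_def)
  then obtain d where d: "d \<in> D" "f d = \<beta>" by blast
  define D' where "D' = {x. prod_encode (x, d) \<in> prod_encode ` R}"
  have D': "x \<in> D' \<longleftrightarrow> x \<in> D \<and> f x < \<beta>" for x
    using iff[of x d] d sub by (auto simp: D'_def image_iff)
  define R' where "R' = {(x, y). (x, y) \<in> R \<and> y \<in> D'}"
  have dR: "decidable (\<lambda>z. z \<in> prod_encode ` R)" using R by (simp add: decidable_iff_computable_set)
  have "decidable (\<lambda>z. z \<in> D')"
    unfolding D'_def mem_Collect_eq by (intro decidable_comp[OF dR] computable)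
  then have cD': "computable_set D'" by (simp add: decidable_iff_computable_set)
  have "decidable (\<lambda>z. z \<in> prod_encode ` R \<and> prod_encode (psnd z, d) \<in> prod_encode ` R)"
    by (intro decidable_conj dR decidable_comp[OF dR] computable)
  moreover have "z \<in> prod_encode ` R \<and> prod_encode (psnd z, d) \<in> prod_encode ` R \<longleftrightarrow> z \<in> prod_encode ` R'" for z
    unfolding R'_def D'_def by (force simp: image_iff)
  ultimately have cR': "computable_set (prod_encode ` R')" by (simp add: decidable_iff_computable_set)
  show ?thesis
    unfolding computable_ordinal_def
  proof (intro exI conjI ballI)
    show "computable_set D'" by fact
    show "computable_set (prod_encode ` R')" by fact
    show "R' \<subseteq> D' \<times> D'"
    proof (clarify, intro conjI)
      fix x y assume "(x, y) \<in> R'"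
      then have xy: "(x, y) \<in> R" "y \<in> D'" by (auto simp: R'_def)
      then have "x \<in> D" "y \<in> D" "f y < \<beta>" using sub D' by auto
      then have "f x < \<beta>" using iff xy(1) less_trans by blast
      with \<open>x \<in> D\<close> show "x \<in> D'" using D' by blast
      show "y \<in> D'" by fact
    qed
    show "bij_betw f D' {\<gamma>. \<gamma> < \<beta>}"
      unfolding bij_betw_def
    proof (intro conjI)
      show "inj_on f D'" using bij D' by (auto simp: bij_betw_def inj_on_def)
      have "f ` D = {\<gamma>. \<gamma> < \<alpha>}" using bij by (simp add: bij_betw_def)
      then show "f ` D' = {\<gamma>. \<gamma> < \<beta>}" using D' assms(2) by (auto simp: set_eq_iff image_iff) (metis less_trans)
    qed
    show "(x, y) \<in> R' \<longleftrightarrow> f x < f y" if "x \<in> D'" "y \<in> D'" for x y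
      using that iff D' by (auto simp: R'_def)
  qed
qed

lemma less_omega1_CK_iff: "\<alpha> < omega1_CK \<longleftrightarrow> computable_ordinal \<alpha>"
proof
  show "\<alpha> < omega1_CK \<Longrightarrow> computable_ordinal \<alpha>"
    unfolding omega1_CK_def using not_less_Least by blast
  show "computable_ordinal \<alpha> \<Longrightarrow> \<alpha> < omega1_CK"
    using not_computable_ordinal_omega1_CK computable_ordinal_downward
    by (metis not_less_iff_gr_or_eq)
qed


section \<open>Depth of a vertex in a graph\<close>

text \<open>
  Arbitrarily many steps are allowed at once, since an opponent in the back-and-forth game may
  choose elements of any higher level of the structure attached to the graph.
\<close>

function deep :: "(nat \<times> nat) set \<Rightarrow> cord \<Rightarrow> nat \<Rightarrow> bool" where
  "deep R \<alpha> y \<longleftrightarrow> (\<forall>\<beta><\<alpha>. \<forall>m. \<exists>y'. (y', y) \<in> R ^^ m \<and> deep R \<beta> y')"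
  by auto
termination
  by (relation "inv_image {(\<beta>, \<alpha>). \<beta> < \<alpha>} (\<lambda>(R, \<alpha>, y). \<alpha>)") (auto intro: wf_inv_image wf)

declare deep.simps [simp del]

lemma deep_antimono: "deep R \<alpha> y \<Longrightarrow> \<beta> \<le> \<alpha> \<Longrightarrow> deep R \<beta> y"
  by (subst deep.simps) (use deep.simps[of R \<alpha>] in \<open>auto dest: order.strict_trans2\<close>)

lemma deepD: "deep R \<alpha> y \<Longrightarrow> \<beta> < \<alpha> \<Longrightarrow> \<exists>y'. (y', y) \<in> R ^^ m \<and> deep R \<beta> y'"
  using deep.simps[of R \<alpha>] by blast

text \<open>
  A walk of \<open>m\<close> steps from \<open>y\<close> either passes through \<open>y'\<close> or stops before. In the first case it is continued by
  the depth of \<open>y'\<close>, in the second its last vertex inherits depth \<open>\<beta>\<close> from \<open>y'\<close> by induction.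
\<close>

lemma deep_reachable: "deep R \<alpha> y' \<Longrightarrow> (y', y) \<in> R ^^ k \<Longrightarrow> deep R \<alpha> y"
proof (induction \<alpha> arbitrary: y y' k rule: less_induct)
  case (less \<alpha>)
  show ?case
  proof (subst deep.simps, intro allI impI)
    fix \<beta> m assume \<beta>: "\<beta> < \<alpha>"
    show "\<exists>z. (z, y) \<in> R ^^ m \<and> deep R \<beta> z"
    proof (cases "k \<le> m")
      case True
      obtain z where "(z, y') \<in> R ^^ (m - k)" "deep R \<beta> z"
        using deepD[OF less.prems(1) \<beta>] by blast
      moreover have "R ^^ m = R ^^ (m - k) O R ^^ k" using True by (simp flip: relpow_add)
      ultimately show ?thesis using less.prems(2) by blast
    next
      case False
      then have "(y', y) \<in> R ^^ (k - m) O R ^^ m"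
        using less.prems(2) by (simp flip: relpow_add)
      then obtain z where "(y', z) \<in> R ^^ (k - m)" "(z, y) \<in> R ^^ m" by blast
      moreover have "deep R \<beta> y'" using deep_antimono[OF less.prems(1)] \<beta> by simp
      ultimately show ?thesis using less.IH[OF \<beta>] by blast
    qed
  qed
qed


section \<open>Finite sets under symmetric difference\<close>

definition xor :: "'a set \<Rightarrow> 'a set \<Rightarrow> 'a set" (infixl "\<oplus>" 65) where
  "A \<oplus> B = {x. x \<in> A \<longleftrightarrow> x \<notin> B}"

lemma in_xor [simp]: "x \<in> A \<oplus> B \<longleftrightarrow> (x \<in> A \<longleftrightarrow> x \<notin> B)"
  by (simp add: xor_def)

lemma finite_xor [simp]: "finite A \<Longrightarrow> finite B \<Longrightarrow> finite (A \<oplus> B)"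
  by (rule finite_subset[of _ "A \<union> B"]) auto

lemma xor_cancel [simp]: "A \<oplus> B \<oplus> B = A" "A \<oplus> {} = A" "A \<oplus> (A \<oplus> B) = B"
  by (auto simp: set_eq_iff)

lemma xor_commute: "A \<oplus> B = B \<oplus> A"
  by (auto simp: set_eq_iff)

lemma odd_card_xor:
  assumes "finite A" and "finite B"
  shows "odd (card (A \<oplus> B)) \<longleftrightarrow> odd (card A) \<noteq> odd (card B)"
proof -
  have "card (A \<oplus> B) = card ((A - B) \<union> (B - A))" by (rule arg_cong[of _ _ card]) auto
  also have "\<dots> = card (A - B) + card (B - A)" using assms by (intro card_Un_disjoint) auto
  finally have "card (A \<oplus> B) = card (A - B) + card (B - A)" .
  moreover note card_Int_Diff[OF assms(1), of B] card_Int_Diff[OF assms(2), of A]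
  moreover have "A \<inter> B = B \<inter> A" by auto
  ultimately show ?thesis by presburger
qed

text \<open>
  The linear extension of \<open>f\<close> to finite sets, as vectors over the field with two elements.
\<close>

definition push :: "('a \<Rightarrow> 'b) \<Rightarrow> 'a set \<Rightarrow> 'b set" where
  "push f A = {u. odd (card {t \<in> A. f t = u})}"

lemma push_subset: "push f A \<subseteq> f ` A"
proof
  fix u assume "u \<in> push f A"
  then have "{t \<in> A. f t = u} \<noteq> {}" unfolding push_def by (metis card.empty even_zero mem_Collect_eq)
  then show "u \<in> f ` A" by blast
qed

lemma finite_push [simp]: "finite A \<Longrightarrow> finite (push f A)"
  by (rule finite_subset[OF push_subset]) simp

lemma push_xor:
  assumes "finite A" and "finite B" shows "push f (A \<oplus> B) = push f A \<oplus> push f B"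
proof -
  have "{t \<in> A \<oplus> B. f t = u} = {t \<in> A. f t = u} \<oplus> {t \<in> B. f t = u}" for u by auto
  then show ?thesis using assms by (auto simp: push_def odd_card_xor)
qed

lemma push_inj:
  assumes "inj_on f A" shows "push f A = f ` A"
proof -
  have "{t \<in> A. f t = u} = (if u \<in> f ` A then {inv_into A f u} else {})" for u
    using assms by (auto simp: inj_on_def intro: f_inv_into_f inv_into_into)
  then show ?thesis by (auto simp: push_def)
qed

lemma push_push:
  assumes "finite A" shows "push g (push f A) = push (g \<circ> f) A"
  using assms
proof (induction A rule: finite_induct)
  case empty
  show ?case by (simp add: push_def)
next
  case (insert t A)
  have "insert t A = {t} \<oplus> A" using insert.hyps(2) by auto
  then show ?case using insert by (simp add: push_xor push_inj)
qed


section \<open>The structure attached to a graph\<close>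

text \<open>
  The code \<open>t\<close> of a list is a node of level \<open>n\<close> if the list is a walk with \<open>n\<close> steps. The last vertex
  of the walk is at the head of the list, so \<open>ldrop m\<close> truncates a walk by \<open>m\<close> steps and the vertex that has to be deep is
  \<open>lhd t\<close>.
\<close>

definition node :: "(nat \<times> nat) set \<Rightarrow> nat \<Rightarrow> nat \<Rightarrow> bool" where
  "node R n t \<longleftrightarrow> ldrop n t \<noteq> 0 \<and> ldrop (Suc n) t = 0 \<and> (\<forall>i<n. (lnth t i, lnth t (Suc i)) \<in> R)"

lemma ldrop_Suc: "ldrop (Suc n) t = ldrop n (ltl t)"
  by (simp add: ldrop_def funpow_swap1)

lemma ldrop_zero [simp]: "ldrop n 0 = 0"
  by (induction n) (auto simp: ldrop_Suc)

lemma lnth_0: "lnth t 0 = lhd t" and lnth_Suc: "lnth t (Suc i) = lnth (ltl t) i"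
  by (simp_all add: lnth_def ldrop_Suc)

lemma node_0: "node R 0 t \<longleftrightarrow> (\<exists>y. t = lcons y 0)"
proof
  assume "node R 0 t"
  then have "t \<noteq> 0" "ltl t = 0" by (auto simp: node_def ldrop_Suc)
  then have "t = lcons (lhd t) 0" using lcons_lhd_ltl[of t] by simp
  then show "\<exists>y. t = lcons y 0" ..
qed (auto simp: node_def ldrop_Suc)

lemma node_Suc: "node R (Suc n) t \<longleftrightarrow> (\<exists>y u. t = lcons y u \<and> node R n u \<and> (y, lhd u) \<in> R)"
proof -
  have eq: "node R (Suc n) (lcons y u) \<longleftrightarrow> node R n u \<and> (y, lhd u) \<in> R" for y u
    by (auto simp: node_def ldrop_Suc All_less_Suc2 lnth_0 lnth_Suc)
  have zero: "\<not> node R (Suc n) 0" by (simp add: node_def)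
  show ?thesis
  proof (cases "t = 0")
    case True
    then show ?thesis using zero by simp
  next
    case False
    then have t: "t = lcons (lhd t) (ltl t)" by simp
    show ?thesis by (subst (1) t, subst eq, subst (3) t) simp
  qed
qed

lemma node_ldrop:
  "node R (n + m) t \<Longrightarrow> node R n (ldrop m t) \<and> (lhd t, lhd (ldrop m t)) \<in> R ^^ m"
proof (induction m arbitrary: t)
  case (Suc m)
  then obtain y u where u: "t = lcons y u" "node R (n + m) u" "(y, lhd u) \<in> R"
    by (auto simp: node_Suc)
  with Suc.IH[of u] show ?case by (auto simp: ldrop_Suc simp del: relpow.simps intro: relpow_Suc_I2)
qed simp

lemma node_extend:
  "node R n t \<Longrightarrow> (y, lhd t) \<in> R ^^ m \<Longrightarrow> \<exists>u. node R (n + m) u \<and> ldrop m u = t \<and> lhd u = y"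
proof (induction m arbitrary: y)
  case 0
  then show ?case by auto
next
  case (Suc m)
  then obtain z where z: "(y, z) \<in> R" "(z, lhd t) \<in> R ^^ m" using relpow_Suc_D2 by metis
  then obtain u where u: "node R (n + m) u" "ldrop m u = t" "lhd u = z" using Suc by blast
  then have "node R (n + Suc m) (lcons y u)" using z(1) by (auto simp: node_Suc)
  with u show ?case by (intro exI[of _ "lcons y u"]) (simp add: ldrop_Suc)
qed

abbreviation lev :: "nat \<Rightarrow> nat" where "lev X \<equiv> pfst X"
abbreviation elt :: "nat \<Rightarrow> nat set" where "elt X \<equiv> set_decode (psnd X)"
definition element :: "nat \<Rightarrow> nat set \<Rightarrow> nat" where "element n A = prod_encode (n, set_encode A)"

lemma element_simps [simp]: "lev (element n A) = n" "finite A \<Longrightarrow> elt (element n A) = A" "element (lev X) (elt X) = X"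
  by (auto simp: element_def)

lemma element_eqI: "lev X = lev Y \<Longrightarrow> elt X = elt Y \<Longrightarrow> X = Y"
  by (metis element_simps(3))

definition nodesets :: "(nat \<times> nat) set \<Rightarrow> nat \<Rightarrow> nat set set" where
  "nodesets R n = {A. finite A \<and> (\<forall>t\<in>A. node R n t)}"

text \<open>
  The relation relates elements of different levels, too. So the atomic formulas already express that
  the differences between two tuples are compatible with truncation. For \<open>g = element n {}\<close> it holds of \<open>(X, X)\<close>
  exactly if \<open>X\<close> has level \<open>n\<close>.
\<close>

definition torsor_rel :: "nat \<Rightarrow> nat \<Rightarrow> nat \<Rightarrow> bool" where
  "torsor_rel g X Y \<longleftrightarrow> lev Y = lev g \<and> lev Y \<le> lev X \<and>
     elt Y = push (ldrop (lev X - lev Y)) (elt X) \<oplus> elt g"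

definition torsor :: "(nat \<times> nat) set \<Rightarrow> nat struct" where
  "torsor R = \<lparr>univ = {X. elt X \<in> nodesets R (lev X)},
     rel = (\<lambda>g as. torsor_rel g (as ! 0) (as ! 1)), fn = (\<lambda>_ _. 0)\<rparr>"

definition torsor_lang :: language where
  "torsor_lang = \<lparr>Rels = UNIV, Funs = {}, rel_arity = (\<lambda>_. 2), fun_arity = (\<lambda>_. 0)\<rparr>"

lemma univ_torsor: "X \<in> univ (torsor R) \<longleftrightarrow> elt X \<in> nodesets R (lev X)"
  by (simp add: torsor_def)

lemma element_in_univ: "A \<in> nodesets R n \<Longrightarrow> element n A \<in> univ (torsor R)"
  by (simp add: univ_torsor nodesets_def)


subsection \<open>Translations\<close>

text \<open>
  The translation by a vector \<open>h\<close> of level \<open>N\<close> acts on the levels up to \<open>N\<close>, by truncations of \<open>h\<close>.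
\<close>

definition shift :: "nat \<Rightarrow> nat set \<Rightarrow> nat \<Rightarrow> nat" where
  "shift N h X = element (lev X) (elt X \<oplus> push (ldrop (N - lev X)) h)"

lemma lev_shift [simp]: "lev (shift N h X) = lev X"
  by (simp add: shift_def)

lemma elt_shift: "finite h \<Longrightarrow> elt (shift N h X) = elt X \<oplus> push (ldrop (N - lev X)) h"
  by (simp add: shift_def)

lemma shift_shift [simp]: "finite h \<Longrightarrow> shift N h (shift N h X) = X"
  by (rule element_eqI) (simp_all add: elt_shift)

lemma push_ldrop_0 [simp]: "push (ldrop 0) h = h"
  by (subst push_inj) (auto simp: inj_on_def)

lemma push_ldrop_push_ldrop:
  "finite h \<Longrightarrow> push (ldrop j) (push (ldrop k) h) = push (ldrop (j + k)) h"
  by (simp add: push_push comp_def ldrop_ldrop)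

lemma push_ldrop_nodesets:
  assumes "h \<in> nodesets R (n + m)" shows "push (ldrop m) h \<in> nodesets R n"
  using assms push_subset[of "ldrop m" h] node_ldrop[of R n m] by (fastforce simp: nodesets_def)

lemma shift_in_univ:
  assumes "h \<in> nodesets R N" and "lev X \<le> N" and "X \<in> univ (torsor R)"
  shows "shift N h X \<in> univ (torsor R)"
proof -
  have "push (ldrop (N - lev X)) h \<in> nodesets R (lev X)"
    using push_ldrop_nodesets[of h R "lev X" "N - lev X"] assms by simp
  then show ?thesis using assms(3) by (auto simp: univ_torsor shift_def nodesets_def)
qed

lemma torsor_rel_shift:
  assumes "finite h" and "lev X \<le> N"
  shows "torsor_rel g (shift N h X) (shift N h Y) \<longleftrightarrow> torsor_rel g X Y"
proof -
  have "push (ldrop (lev X - lev Y)) (push (ldrop (N - lev X)) h) = push (ldrop (N - lev Y)) h"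
    if "lev Y \<le> lev X"
    using that assms by (simp add: push_ldrop_push_ldrop)
  then show ?thesis
    unfolding torsor_rel_def using assms(1)
    by (auto simp: elt_shift push_xor set_eq_iff)
qed

lemma shift_coarsen:
  assumes "finite h" and "lev X \<le> n" and "n \<le> N"
  shows "shift N h X = shift n (push (ldrop (N - n)) h) X"
  using assms by - (rule element_eqI, simp_all add: elt_shift push_ldrop_push_ldrop)


subsection \<open>Back-and-forth equivalence\<close>

lemma same_atomic_torsorD:
  assumes "same_atomic torsor_lang (torsor R) as bs" and "i < length as" and "j < length as"
  shows "torsor_rel g (as ! i) (as ! j) \<longleftrightarrow> torsor_rel g (bs ! i) (bs ! j)"
proof -
  have "Rel g [Var i, Var j] \<in> formulas torsor_lang (length as)"
    using assms(2,3) by (simp add: formulas_def torsor_lang_def)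
  from assms(1)[unfolded same_atomic_def, THEN conjunct2, rule_format, OF this]
  show ?thesis by (simp add: torsor_def)
qed

lemma same_atomic_shift:
  assumes h: "finite h" and le: "\<And>a. a \<in> set as \<Longrightarrow> lev a \<le> N"
  shows "same_atomic torsor_lang (torsor R) as (map (shift N h) as)"
  unfolding same_atomic_def
proof (intro conjI ballI impI)
  fix \<phi> assume \<phi>: "\<phi> \<in> formulas torsor_lang (length as)" and "atomic \<phi>"
  have var: "\<exists>i. t = Var i" if "wf_trm torsor_lang t" for t
    using that by (cases t) (auto simp: torsor_lang_def)
  show "sat (torsor R) \<phi> ((!) as) \<longleftrightarrow> sat (torsor R) \<phi> ((!) (map (shift N h) as))"
  proof (cases \<phi>)
    case (Eq s t)
    with \<phi> have st: "wf_trm torsor_lang s" "wf_trm torsor_lang t" "fv \<phi> \<subseteq> {..<length as}"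
      by (auto simp: formulas_def)
    obtain i where i: "s = Var i" using var[OF st(1)] by blast
    obtain j where j: "t = Var j" using var[OF st(2)] by blast
    have "shift N h X = shift N h Y \<longleftrightarrow> X = Y" for X Y by (metis shift_shift[OF h])
    then show ?thesis using Eq i j st(3) by simp
  next
    case (Rel r ts)
    with \<phi> have "length ts = 2" "list_all (wf_trm torsor_lang) ts"
      by (auto simp: formulas_def torsor_lang_def)
    then obtain s t where ts: "ts = [s, t]" "wf_trm torsor_lang s" "wf_trm torsor_lang t"
      by (auto simp: length_Suc_conv numeral_2_eq_2)
    obtain i where i: "s = Var i" using var[OF ts(2)] by blast
    obtain j where j: "t = Var j" using var[OF ts(3)] by blast
    have "i < length as" "j < length as" using \<phi> Rel ts(1) i j by (auto simp: formulas_def)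
    then show ?thesis
      using Rel ts(1) i j torsor_rel_shift[OF h le, of "as ! i"] by (simp add: torsor_def)
  qed (use \<open>atomic \<phi>\<close> in auto)
qed simp

text \<open>
  The differences between corresponding entries of \<open>as\<close> and \<open>bs\<close> are all truncations of the difference at an entry of
  maximal level. The element \<open>a\<close> of that level serves to recover \<open>h\<close> from the translation.
\<close>

lemma same_atomic_imp_shift:
  assumes as: "as \<in> lists (univ (torsor R))" and bs: "bs \<in> lists (univ (torsor R))"
    and same: "same_atomic torsor_lang (torsor R) as bs" and "as \<noteq> []"
  obtains N h a where "h \<in> nodesets R N" "\<And>a. a \<in> set as \<Longrightarrow> lev a \<le> N"
    "a \<in> set as" "lev a = N" "bs = map (shift N h) as"
proof -
  have len: "length as = length bs" using same by (simp add: same_atomic_def)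
  have lev: "lev (bs ! i) = lev (as ! i)" if "i < length as" for i
    using same_atomic_torsorD[OF same that that, of "element (lev (as ! i)) {}"]
    by (simp add: torsor_rel_def)
  have diff: "elt (bs ! j) = push (ldrop (lev (as ! i) - lev (as ! j))) (elt (bs ! i)) \<oplus>
      (push (ldrop (lev (as ! i) - lev (as ! j))) (elt (as ! i)) \<oplus> elt (as ! j))"
    if "i < length as" "j < length as" "lev (as ! j) \<le> lev (as ! i)" for i j
    using same_atomic_torsorD[OF same that(1,2), of "element (lev (as ! j))
        (push (ldrop (lev (as ! i) - lev (as ! j))) (elt (as ! i)) \<oplus> elt (as ! j))"] that lev
    by (simp add: torsor_rel_def)
  define N where "N = Max (lev ` set as)"
  have le: "lev a \<le> N" if "a \<in> set as" for a using that by (simp add: N_def)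
  have "N \<in> lev ` set as" unfolding N_def using \<open>as \<noteq> []\<close> by (intro Max_in) auto
  then obtain i where i: "i < length as" "lev (as ! i) = N" by (auto simp: in_set_conv_nth)
  define h where "h = elt (as ! i) \<oplus> elt (bs ! i)"
  have "as ! i \<in> univ (torsor R)" "bs ! i \<in> univ (torsor R)"
    using as bs i len by (auto simp: in_lists_conv_set)
  then have h: "h \<in> nodesets R N" using i lev[of i] by (auto simp: h_def univ_torsor nodesets_def)
  have "bs = map (shift N h) as"
  proof (rule nth_equalityI)
    fix j assume "j < length bs"
    then have j: "j < length as" using len by simp
    then have ji: "lev (as ! j) \<le> lev (as ! i)" using le i by simp
    have "bs ! j = shift N h (as ! j)"
    proof (rule element_eqI)
      show "elt (bs ! j) = elt (shift N h (as ! j))"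
        using diff[OF i(1) j ji] i by (auto simp: elt_shift h_def push_xor set_eq_iff)
    qed (simp add: lev j)
    then show "bs ! j = map (shift N h) as ! j" using j by simp
  qed (simp add: len)
  with that[OF h le nth_mem[OF i(1)] i(2)] show ?thesis by blast
qed

lemma back_forth_length: "back_forth L M \<alpha> as bs \<Longrightarrow> length as = length bs"
  by (subst (asm) back_forth.simps) simp

lemma back_forth_forth:
  "back_forth L M \<alpha> as bs \<Longrightarrow> \<beta> < \<alpha> \<Longrightarrow> cs \<in> lists (univ M) \<Longrightarrow>
     \<exists>ds\<in>lists (univ M). length cs = length ds \<and> back_forth L M \<beta> (as @ cs) (bs @ ds)"
  by (subst (asm) back_forth.simps) (auto split: if_splits simp: zero_cord_def dest: not_less_Least)

lemma zero_le_cord [simp]: "0 \<le> (\<alpha> :: cord)"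
  unfolding zero_cord_def by (rule Least_le) simp

lemma back_forth_imp_same_atomic:
  assumes "back_forth L M \<alpha> as bs" shows "same_atomic L M as bs"
proof (cases "\<alpha> = 0")
  case True
  with assms show ?thesis by (subst (asm) back_forth.simps) simp
next
  case False
  then have "0 < \<alpha>" by (simp add: order.not_eq_order_implies_strict)
  from back_forth_forth[OF assms this, of "[]"] have "back_forth L M 0 as bs" by simp
  then show ?thesis by (subst (asm) back_forth.simps) simp
qed

text \<open>
  The combinatorial form of \<open>\<alpha>\<close>-equivalence.
\<close>

definition deep_shift :: "(nat \<times> nat) set \<Rightarrow> cord \<Rightarrow> nat list \<Rightarrow> nat list \<Rightarrow> bool" where
  "deep_shift R \<alpha> as bs \<longleftrightarrow> (\<exists>N h. h \<in> nodesets R N \<and> (\<forall>a\<in>set as. lev a \<le> N) \<and>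
     bs = map (shift N h) as \<and> (\<forall>t\<in>h. deep R \<alpha> (lhd t)))"

lemma deep_shift_sym: "deep_shift R \<alpha> as bs \<Longrightarrow> deep_shift R \<alpha> bs as"
proof -
  assume "deep_shift R \<alpha> as bs"
  then obtain N h where h: "h \<in> nodesets R N" "\<forall>a\<in>set as. lev a \<le> N" "bs = map (shift N h) as"
    "\<forall>t\<in>h. deep R \<alpha> (lhd t)" by (auto simp: deep_shift_def)
  then have "as = map (shift N h) bs" by (simp add: nodesets_def map_idI)
  moreover have "\<forall>b\<in>set bs. lev b \<le> N" using h(2,3) by simp
  ultimately show ?thesis unfolding deep_shift_def using h(1,4) by blast
qed

text \<open>
  The walks in \<open>h\<close> are prolonged to the maximal level of the new elements, at the cost of lowering
  the depth from \<open>\<alpha>\<close> to \<open>\<beta>\<close>. Distinct walks have distinct prolongations, so the set \<open>h'\<close> of prolongations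
  is pushed forward to \<open>h\<close> without cancellation, and translating by it extends the given translation.
\<close>

lemma deep_shift_extend:
  assumes ds: "deep_shift R \<alpha> as bs" and \<beta>: "\<beta> < \<alpha>" and cs: "cs \<in> lists (univ (torsor R))"
  shows "\<exists>ds\<in>lists (univ (torsor R)). length cs = length ds \<and> deep_shift R \<beta> (as @ cs) (bs @ ds)"
proof -
  obtain N h where h: "h \<in> nodesets R N" and le: "\<forall>a\<in>set as. lev a \<le> N"
    and bs: "bs = map (shift N h) as" and deep: "\<forall>t\<in>h. deep R \<alpha> (lhd t)"
    using ds by (auto simp: deep_shift_def)
  have fin: "finite h" using h by (simp add: nodesets_def)
  define m where "m = Max (insert 0 (lev ` set cs))"
  have m: "lev c \<le> m" if "c \<in> set cs" for c using that by (simp add: m_def)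
  have "\<exists>u. node R (N + m) u \<and> ldrop m u = t \<and> deep R \<beta> (lhd u)" if "t \<in> h" for t
  proof -
    have "node R N t" using h that by (simp add: nodesets_def)
    moreover obtain y where "(y, lhd t) \<in> R ^^ m" "deep R \<beta> y"
      using deepD[OF _ \<beta>] deep \<open>t \<in> h\<close> by blast
    ultimately show ?thesis using node_extend by blast
  qed
  then obtain c where c: "\<And>t. t \<in> h \<Longrightarrow> node R (N + m) (c t) \<and> ldrop m (c t) = t \<and> deep R \<beta> (lhd (c t))"
    by metis
  define h' where "h' = c ` h"
  have h': "h' \<in> nodesets R (N + m)" using c fin by (auto simp: h'_def nodesets_def)
  then have fin': "finite h'" by (simp add: nodesets_def)
  have "push (ldrop m) h' = ldrop m ` h'"
    using c by (intro push_inj) (auto simp: inj_on_def h'_def)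
  also have "\<dots> = h" using c by (force simp: h'_def)
  finally have push: "push (ldrop m) h' = h" .
  have bs': "bs = map (shift (N + m) h') as"
    using bs le shift_coarsen[OF fin', of _ N "N + m"] push by simp
  define es where "es = map (shift (N + m) h') cs"
  have "es \<in> lists (univ (torsor R))"
    using cs m shift_in_univ[OF h'] by (auto simp: es_def in_lists_conv_set intro: trans_le_add2)
  moreover have "deep_shift R \<beta> (as @ cs) (bs @ es)"
    unfolding deep_shift_def
  proof (intro exI conjI)
    show "\<forall>a\<in>set (as @ cs). lev a \<le> N + m" using le m by (auto intro: trans_le_add1 trans_le_add2)
    show "bs @ es = map (shift (N + m) h') (as @ cs)" using bs' by (simp add: es_def)
    show "\<forall>t\<in>h'. deep R \<beta> (lhd t)" using c by (auto simp: h'_def)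
  qed (rule h')
  ultimately show ?thesis by (intro bexI[of _ es]) (auto simp: es_def)
qed

text \<open>
  To see that \<open>t \<in> h\<close> is deep, let the opponent play the empty set \<open>m\<close> levels above \<open>h\<close>. The answer and the induction hypothesis
  yield a set \<open>h'\<close> of walks that are deep to \<open>\<beta>\<close> and whose truncations sum up to \<open>h\<close>; hence one of these walks
  extends \<open>t\<close>.
\<close>

lemma back_forth_imp_deep_shift:
  assumes "back_forth torsor_lang (torsor R) \<alpha> as bs"
    and "as \<in> lists (univ (torsor R))" and "bs \<in> lists (univ (torsor R))"
  shows "deep_shift R \<alpha> as bs"
  using assms
proof (induction \<alpha> arbitrary: as bs rule: less_induct)
  case (less \<alpha>)
  show ?case
  proof (cases "as = []")
    case True
    with back_forth_length[OF less.prems(1)] show ?thesis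
      unfolding deep_shift_def by (intro exI[of _ 0] exI[of _ "{}"]) (simp add: nodesets_def)
  next
    case False
    obtain N h a where h: "h \<in> nodesets R N" and le: "\<And>a. a \<in> set as \<Longrightarrow> lev a \<le> N"
      and a: "a \<in> set as" "lev a = N" and bs: "bs = map (shift N h) as"
      using same_atomic_imp_shift[OF less.prems(2,3) back_forth_imp_same_atomic[OF less.prems(1)] False]
      by metis
    have fin: "finite h" using h by (simp add: nodesets_def)
    have "deep R \<alpha> (lhd t)" if t: "t \<in> h" for t
    proof (subst deep.simps, intro allI impI)
      fix \<beta> m assume \<beta>: "\<beta> < \<alpha>"
      let ?c = "element (N + m) {}"
      have c: "[?c] \<in> lists (univ (torsor R))" by (simp add: element_in_univ nodesets_def)
      obtain ds where ds: "ds \<in> lists (univ (torsor R))" "length [?c] = length ds"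
        "back_forth torsor_lang (torsor R) \<beta> (as @ [?c]) (bs @ ds)"
        using back_forth_forth[OF less.prems(1) \<beta> c] by blast
      have "as @ [?c] \<in> lists (univ (torsor R))" "bs @ ds \<in> lists (univ (torsor R))"
        using less.prems(2,3) c ds(1) by auto
      from less.IH[OF \<beta> ds(3) this] obtain N' h' where h': "h' \<in> nodesets R N'"
        and le': "\<forall>a\<in>set (as @ [?c]). lev a \<le> N'" and eq: "bs @ ds = map (shift N' h') (as @ [?c])"
        and deep: "\<forall>t\<in>h'. deep R \<beta> (lhd t)"
        unfolding deep_shift_def by blast
      have fin': "finite h'" using h' by (simp add: nodesets_def)
      have N': "N + m \<le> N'" using le' by simp
      have "map (shift N h) as = map (shift N' h') as" using eq bs by simp
      then have "shift N h a = shift N' h' a" using a(1) by simp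
      then have "elt a \<oplus> h = elt a \<oplus> push (ldrop (N' - N)) h'"
        using elt_shift[OF fin, of N a] elt_shift[OF fin', of N' a] a(2) by simp
      then have "h = push (ldrop (N' - N)) h'" by (metis xor_cancel(3))
      then obtain t' where t': "t' \<in> h'" "ldrop (N' - N) t' = t"
        using t push_subset[of "ldrop (N' - N)" h'] by auto
      define u where "u = ldrop (N' - (N + m)) t'"
      have "node R ((N + m) + (N' - (N + m))) t'" using h' t' N' by (simp add: nodesets_def)
      from node_ldrop[OF this] have u: "node R (N + m) u" "(lhd t', lhd u) \<in> R ^^ (N' - (N + m))"
        by (auto simp: u_def)
      have "ldrop m u = t" using t' N' by (simp add: u_def ldrop_ldrop)
      then have "(lhd u, lhd t) \<in> R ^^ m" using node_ldrop[OF u(1)] by simp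
      moreover have "deep R \<beta> (lhd u)" using deep_reachable[OF _ u(2)] deep t' by blast
      ultimately show "\<exists>y. (y, lhd t) \<in> R ^^ m \<and> deep R \<beta> y" by blast
    qed
    with h le bs show ?thesis unfolding deep_shift_def by blast
  qed
qed

lemma deep_shift_imp_back_forth:
  assumes "deep_shift R \<alpha> as bs"
    and "as \<in> lists (univ (torsor R))" and "bs \<in> lists (univ (torsor R))"
  shows "back_forth torsor_lang (torsor R) \<alpha> as bs"
  using assms
proof (induction \<alpha> arbitrary: as bs rule: less_induct)
  case (less \<alpha>)
  have len: "length as = length bs" using less.prems(1) by (auto simp: deep_shift_def)
  have "same_atomic torsor_lang (torsor R) as bs"
    using less.prems(1) same_atomic_shift by (auto simp: deep_shift_def nodesets_def)
  moreover have "\<exists>ds\<in>lists (univ (torsor R)). length cs = length ds \<and>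
      back_forth torsor_lang (torsor R) \<beta> (as @ cs) (bs @ ds)"
    if \<beta>: "\<beta> < \<alpha>" and cs: "cs \<in> lists (univ (torsor R))" for \<beta> cs
  proof -
    obtain ds where "ds \<in> lists (univ (torsor R))" "length cs = length ds" "deep_shift R \<beta> (as @ cs) (bs @ ds)"
      using deep_shift_extend[OF less.prems(1) \<beta> cs] by blast
    then show ?thesis using less.IH[OF \<beta>] less.prems(2,3) cs by (metis append_in_lists_conv)
  qed
  moreover have "\<exists>cs\<in>lists (univ (torsor R)). length cs = length ds \<and>
      back_forth torsor_lang (torsor R) \<beta> (as @ cs) (bs @ ds)"
    if \<beta>: "\<beta> < \<alpha>" and ds: "ds \<in> lists (univ (torsor R))" for \<beta> ds
  proof -
    obtain cs where "cs \<in> lists (univ (torsor R))" "length ds = length cs" "deep_shift R \<beta> (bs @ ds) (as @ cs)"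
      using deep_shift_extend[OF deep_shift_sym[OF less.prems(1)] \<beta> ds] by blast
    then show ?thesis using less.IH[OF \<beta> deep_shift_sym] less.prems(2,3) ds by (metis append_in_lists_conv)
  qed
  ultimately show ?case by (subst back_forth.simps) (simp add: len)
qed


section \<open>Depth in decidable graphs\<close>

text \<open>
  Depth never exceeds a rank that decreases along the edges. The rank may depend on additional
  data \<open>a\<close> above the vertex \<open>g a\<close>, such as a walk that leads to it, as long as edges lift.
\<close>

lemma deep_imp_le_rank:
  fixes f :: "'a \<Rightarrow> cord"
  assumes step: "\<And>a y. a \<in> Z \<Longrightarrow> (y, g a) \<in> R \<Longrightarrow> \<exists>b\<in>Z. g b = y \<and> f b < f a"
  shows "a \<in> Z \<Longrightarrow> deep R \<beta> (g a) \<Longrightarrow> \<beta> \<le> f a"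
proof (induction "f a" arbitrary: a \<beta> rule: less_induct)
  case less
  show ?case
  proof (rule ccontr)
    assume "\<not> \<beta> \<le> f a"
    then obtain y where y: "(y, g a) \<in> R" "deep R (f a) y"
      using deepD[OF less.prems(2), of "f a" 1] by (auto simp: not_le)
    then obtain b where "b \<in> Z" "g b = y" "f b < f a" using step[OF less.prems(1)] by blast
    then show False using less.hyps[of b "f a"] y(2) by auto
  qed
qed

text \<open>
  Outside the well-founded part there are always further steps that stay outside.
\<close>

lemma not_acc_imp_deep:
  assumes "y \<notin> Wellfounded.acc R" shows "deep R \<alpha> y"
  using assms
proof (induction \<alpha> arbitrary: y rule: less_induct)
  case (less \<alpha>)
  have "\<exists>y'. (y', y) \<in> R ^^ m \<and> y' \<notin> Wellfounded.acc R" for m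
  proof (induction m)
    case 0
    show ?case using less.prems by auto
  next
    case (Suc m)
    then obtain y' where y': "(y', y) \<in> R ^^ m" "y' \<notin> Wellfounded.acc R" by blast
    then obtain z where "(z, y') \<in> R" "z \<notin> Wellfounded.acc R" using accI[of y' R] by blast
    with y' show ?case using relpow_Suc_I2 by metis
  qed
  then show ?case using less.IH by (subst deep.simps) blast
qed


subsection \<open>The Kleene-Brouwer ordering\<close>

text \<open>
  Lists grow at their heads, so this is the Kleene-Brouwer ordering of the reversed lists:
  extensions come first, and otherwise the entries at the first difference from the right decide.
\<close>

definition kb :: "nat list \<Rightarrow> nat list \<Rightarrow> bool" where
  "kb v u \<longleftrightarrow> strict_suffix u v \<or> (\<exists>a b c x y. v = a @ x # c \<and> u = b @ y # c \<and> x < y)"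

definition walk :: "(nat \<times> nat) set \<Rightarrow> nat list \<Rightarrow> bool" where
  "walk R v \<longleftrightarrow> v \<noteq> [] \<and> successively (\<lambda>x y. (x, y) \<in> R) v"

definition extensions :: "(nat \<times> nat) set \<Rightarrow> nat list \<Rightarrow> nat list set" where
  "extensions R t = {v. walk R v \<and> suffix t v}"

definition kb_rel :: "(nat \<times> nat) set \<Rightarrow> nat list \<Rightarrow> (nat list \<times> nat list) set" where
  "kb_rel R t = {(v, u). v \<in> extensions R t \<and> u \<in> extensions R t \<and> kb v u}"

lemma kb_irrefl: "\<not> kb v v"
  by (auto simp: kb_def)

lemma kb_total: "u = v \<or> kb u v \<or> kb v u"
proof (cases "suffix u v \<or> suffix v u")
  case True
  then show ?thesis by (auto simp: kb_def strict_suffix_def)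
next
  case False
  then have "rev u \<parallel> rev v" by (simp add: suffix_to_prefix parallel_def)
  then obtain as b bs c cs where "b \<noteq> c" "rev u = as @ b # bs" "rev v = as @ c # cs"
    using parallel_decomp by blast
  then have "u = rev bs @ b # rev as" "v = rev cs @ c # rev as"
    by (metis append.assoc append_Cons append_Nil rev.simps(2) rev_append rev_rev_ident)+
  moreover have "b < c \<or> c < b" using \<open>b \<noteq> c\<close> by auto
  ultimately show ?thesis unfolding kb_def by blast
qed

lemma extensions_child:
  assumes "v \<in> extensions R t" and "v \<noteq> t" and "t \<noteq> []"
  shows "\<exists>x. v \<in> extensions R (x # t)"
proof -
  obtain p where "v = p @ t" using assms(1) by (auto simp: extensions_def suffix_def)
  with assms(2) obtain q x where "p = q @ [x]" by (cases p rule: rev_cases) auto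
  then have "suffix (x # t) v" using \<open>v = p @ t\<close> by (simp add: suffix_def)
  then show ?thesis using assms(1) by (auto simp: extensions_def)
qed

lemma extensions_child_edge:
  assumes "v \<in> extensions R (x # t)" and "t \<noteq> []" shows "(x, hd t) \<in> R"
proof -
  obtain p where "v = p @ x # t" using assms(1) by (auto simp: extensions_def suffix_def)
  then have "successively (\<lambda>x y. (x, y) \<in> R) (x # t)"
    using assms(1) by (auto simp: extensions_def walk_def successively_append_iff)
  then show ?thesis using assms(2) by (cases t) auto
qed

text \<open>
  The subtrees above the children \<open>x # t\<close> of a node \<open>t\<close> are ordered as their labels \<open>x\<close>.
\<close>

lemma kb_child:
  assumes kb: "kb v u" and v: "v \<in> extensions R t" and u: "u \<in> extensions R (y # t)"
  shows "\<exists>x\<le>y. v \<in> extensions R (x # t)"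
  using kb unfolding kb_def
proof (elim disjE exE conjE)
  assume "strict_suffix u v"
  then have "suffix (y # t) v" using u by (auto simp: extensions_def intro: suffix_order.trans)
  then show ?thesis using v by (auto simp: extensions_def)
next
  fix a b c x z assume eq: "v = a @ x # c" "u = b @ z # c" "x < z"
  have tv: "suffix t v" and tu: "suffix (y # t) u" using u v by (auto simp: extensions_def)
  have walk: "walk R v" using v by (simp add: extensions_def)
  have cu: "suffix (z # c) u" and cv: "suffix (x # c) v" using eq by (auto simp: suffix_def)
  consider "length t < length c" | "length c = length t" | "length c < length t" by linarith
  then show ?thesis
  proof cases
    case 1
    then have "suffix (y # t) c"
      using suffix_length_suffix[OF tu suffix_ConsD[OF cu]] 1 by simp
    then have "suffix (y # t) v" using suffix_ConsD[OF cv] suffix_order.trans by blast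
    then show ?thesis using walk by (auto simp: extensions_def)
  next
    case 2
    then have "suffix (y # t) (z # c)" using suffix_length_suffix[OF tu cu] 2 by simp
    then obtain p where p: "z # c = p @ y # t" by (auto simp: suffix_def)
    then have "length (z # c) = length (p @ y # t)" by (rule arg_cong)
    then have "p = []" using 2 by simp
    with p have "y # t = z # c" by simp
    then have "x \<le> y" "v \<in> extensions R (x # t)" using eq(3) cv walk by (auto simp: extensions_def)
    then show ?thesis by blast
  next
    case 3
    then have "suffix (x # c) t" using suffix_length_suffix[OF cv tv] 3 by simp
    moreover have "suffix (z # c) t"
      using suffix_length_suffix[OF cu suffix_ConsD[OF tu]] 3 by simp
    ultimately obtain p q where "p @ x # c = q @ z # c" by (auto simp: suffix_def)
    then have "x = z" by (simp add: append_eq_append_conv)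
    then show ?thesis using eq(3) by simp
  qed
qed

text \<open>
  By induction along the graph, the ordering is well-founded on the subtree above each child of
  \<open>t\<close>. By \<open>kb_child\<close> the subtree above \<open>t\<close> is the sum of these well-founded orders over the natural
  numbers as labels, followed by \<open>t\<close> itself.
\<close>

lemma wf_kb_rel:
  "x \<in> Wellfounded.acc R \<Longrightarrow> hd t = x \<Longrightarrow> t \<noteq> [] \<Longrightarrow> wf (kb_rel R t)"
proof (induction x arbitrary: t rule: acc.induct)
  case (accI x)
  have child: "\<forall>v\<in>extensions R (y # t). v \<in> Wellfounded.acc (kb_rel R t)" for y
  proof (induction y rule: less_induct)
    case (less y)
    note left = less.IH
    show ?case
    proof
      fix v assume v: "v \<in> extensions R (y # t)"
      then have "(y, hd t) \<in> R" using extensions_child_edge accI.prems(2) by blast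
      then have "wf (kb_rel R (y # t))" using accI.IH[of y "y # t"] accI.prems(1) by simp
      then show "v \<in> Wellfounded.acc (kb_rel R t)"
        using v
      proof (induction v rule: wf_induct_rule)
        case (less v)
        show ?case
        proof (rule acc.accI)
          fix w assume "(w, v) \<in> kb_rel R t"
          then have w: "w \<in> extensions R t" "kb w v" by (auto simp: kb_rel_def)
          from kb_child[OF w(2,1) less.prems] obtain x where x: "x \<le> y" "w \<in> extensions R (x # t)"
            by blast
          show "w \<in> Wellfounded.acc (kb_rel R t)"
          proof (cases "x = y")
            case True
            then show ?thesis using less.IH[of w] less.prems x w by (auto simp: kb_rel_def)
          next
            case False
            then have "x < y" using x(1) by simp
            then show ?thesis using left x(2) by blast
          qed
        qed
      qed
    qed
  qed
  have ext: "v \<in> Wellfounded.acc (kb_rel R t)" if "v \<in> extensions R t" "v \<noteq> t" for v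
    using extensions_child[OF that accI.prems(2)] child by blast
  have "v \<in> Wellfounded.acc (kb_rel R t)" for v
  proof (rule acc.accI)
    fix w assume "(w, v) \<in> kb_rel R t"
    then have w: "w \<in> extensions R t" "v \<in> extensions R t" "kb w v" by (auto simp: kb_rel_def)
    show "w \<in> Wellfounded.acc (kb_rel R t)"
    proof (cases "v = t")
      case True
      then show ?thesis using ext w kb_irrefl by metis
    next
      case False
      then show ?thesis using ext[OF w(2)] \<open>(w, v) \<in> kb_rel R t\<close> by (meson acc_downward)
    qed
  qed
  then show ?case by (intro acc_wfI) blast
qed


subsection \<open>Coding the ordering\<close>

lemma not_node_zero [simp]: "\<not> node R n 0"
  by (simp add: node_def)

lemma node_list_encode:
  "node R n (list_encode v) \<longleftrightarrow> length v = Suc n \<and> successively (\<lambda>x y. (x, y) \<in> R) v"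
proof (induction v arbitrary: n)
  case Nil
  show ?case by (simp add: node_def)
next
  case (Cons a v)
  show ?case
  proof (cases n)
    case 0
    then show ?thesis by (cases v) (auto simp: list_encode_Cons node_0 simp del: list_encode.simps(2))
  next
    case (Suc m)
    have "node R n (list_encode (a # v)) \<longleftrightarrow> node R m (list_encode v) \<and> (a, lhd (list_encode v)) \<in> R"
      unfolding Suc list_encode_Cons node_Suc by auto
    also have "\<dots> \<longleftrightarrow> length (a # v) = Suc n \<and> successively (\<lambda>x y. (x, y) \<in> R) (a # v)"
      using Suc Cons.IH[of m]
      by (cases v) (auto simp: lhd_list_encode simp del: list_encode.simps(2))
    finally show ?thesis .
  qed
qed

text \<open>
  The codes of the walks from \<open>y\<close>. The bound on \<open>n\<close> is harmless, as a list is never longer than its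
  code, and makes the set decidable.
\<close>

definition root_nodes :: "(nat \<times> nat) set \<Rightarrow> nat \<Rightarrow> nat set" where
  "root_nodes R y = {t. \<exists>n\<le>t. node R n t \<and> lnth t n = y}"

lemma root_nodes_iff: "list_encode v \<in> root_nodes R y \<longleftrightarrow> v \<in> extensions R [y]"
proof -
  have "suffix [y] v \<longleftrightarrow> v \<noteq> [] \<and> last v = y"
    by (cases v rule: rev_cases) (auto simp: suffix_def)
  moreover have "v \<noteq> [] \<Longrightarrow> length v - 1 \<le> list_encode v"
    using length_le_list_encode[of v] by simp
  ultimately show ?thesis
    by (cases "v = []") (auto simp: root_nodes_def extensions_def walk_def node_list_encode
        lnth_list_encode last_conv_nth intro!: exI[of _ "length v - 1"])
qed

definition kb_code :: "nat \<Rightarrow> nat \<Rightarrow> bool" where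
  "kb_code v u \<longleftrightarrow> (\<exists>k\<le>v. 0 < k \<and> ldrop k v = u) \<or>
     (\<exists>i\<le>v. \<exists>j\<le>u. ldrop i v \<noteq> 0 \<and> ldrop j u \<noteq> 0 \<and> ldrop (Suc i) v = ldrop (Suc j) u \<and>
        lnth v i < lnth u j)"

lemma kb_code_iff:
  assumes "v \<noteq> []" shows "kb_code (list_encode v) (list_encode u) \<longleftrightarrow> kb v u"
proof -
  have "(\<exists>k\<le>list_encode v. 0 < k \<and> drop k v = u) \<longleftrightarrow> strict_suffix u v"
  proof
    assume "\<exists>k\<le>list_encode v. 0 < k \<and> drop k v = u"
    then obtain k where k: "0 < k" "drop k v = u" by blast
    then have "length u < length v" using assms by auto
    moreover have "suffix u v" using k(2) suffix_drop by blast
    ultimately show "strict_suffix u v" by (auto simp: strict_suffix_def)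
  next
    assume "strict_suffix u v"
    then obtain p where p: "v = p @ u" "p \<noteq> []" by (auto simp: strict_suffix_def suffix_def)
    then show "\<exists>k\<le>list_encode v. 0 < k \<and> drop k v = u"
      using length_le_list_encode[of v] by (intro exI[of _ "length p"]) auto
  qed
  moreover have "(\<exists>i\<le>list_encode v. \<exists>j\<le>list_encode u. i < length v \<and> j < length u \<and>
      drop (Suc i) v = drop (Suc j) u \<and> v ! i < u ! j) \<longleftrightarrow>
      (\<exists>a b c x y. v = a @ x # c \<and> u = b @ y # c \<and> x < y)"
  proof (intro iffI; elim exE conjE)
    fix i j assume ij: "i < length v" "j < length u" "drop (Suc i) v = drop (Suc j) u" "v ! i < u ! j"
    have "v = take i v @ v ! i # drop (Suc i) v" using ij(1) by (rule id_take_nth_drop)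
    moreover have "u = take j u @ u ! j # drop (Suc i) v"
      unfolding ij(3) using ij(2) by (rule id_take_nth_drop)
    ultimately show "\<exists>a b c x y. v = a @ x # c \<and> u = b @ y # c \<and> x < y" using ij(4) by blast
  next
    fix a b c x y assume eq: "v = a @ x # c" "u = b @ y # c" "x < y"
    then show "\<exists>i\<le>list_encode v. \<exists>j\<le>list_encode u. i < length v \<and> j < length u \<and>
        drop (Suc i) v = drop (Suc j) u \<and> v ! i < u ! j"
      using length_le_list_encode[of v] length_le_list_encode[of u]
      by (intro exI[of _ "length a"] exI[of _ "length b"] conjI) auto
  qed
  moreover have "kb_code (list_encode v) (list_encode u) \<longleftrightarrow>
      (\<exists>k\<le>list_encode v. 0 < k \<and> drop k v = u) \<or>
      (\<exists>i\<le>list_encode v. \<exists>j\<le>list_encode u. i < length v \<and> j < length u \<and>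
        drop (Suc i) v = drop (Suc j) u \<and> v ! i < u ! j)"
    by (simp only: kb_code_def ldrop_list_encode list_encode_eq_0 list_encode_eq drop_eq_Nil not_le
        lnth_list_encode if_True cong: conj_cong)
  ultimately show ?thesis by (simp only: kb_def)
qed

definition decidable_rel :: "(nat \<times> nat) set \<Rightarrow> bool" where
  "decidable_rel R \<longleftrightarrow> decidable (\<lambda>z. prod_decode z \<in> R)"

lemma decidable_relD:
  assumes "decidable_rel R" and "computable_fun f" and "computable_fun g"
  shows "decidable (\<lambda>e. (f e, g e) \<in> R)"
proof -
  have "decidable (\<lambda>e. prod_decode (prod_encode (f e, g e)) \<in> R)"
    using assms(1) unfolding decidable_rel_def by (rule decidable_comp) (intro computable assms)
  then show ?thesis by simp
qed

lemma decidable_node: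
  assumes R: "decidable_rel R" and f: "computable_fun f" and g: "computable_fun g"
  shows "decidable (\<lambda>e. node R (f e) (g e))"
proof -
  have "decidable (\<lambda>z. node R (pfst z) (psnd z))"
    unfolding node_def by (intro computable decidable_relD[OF R])
  then have "decidable (\<lambda>e. node R (pfst (prod_encode (f e, g e))) (psnd (prod_encode (f e, g e))))"
    by (rule decidable_comp) (intro computable f g)
  then show ?thesis by simp
qed

text \<open>
  If \<open>y\<close> lies in the well-founded part, the Kleene-Brouwer ordering of the walks from \<open>y\<close> presents a computable
  ordinal \<open>\<alpha>\<close>, and the position of a walk in it bounds the depth of its last vertex. So \<open>y\<close>
  has depth below \<open>\<alpha> < \<omega>\<^sub>1\<^sup>C\<^sup>K\<close>, contrary to the assumption.
\<close>

lemma deep_omega1_CK: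
  assumes R: "decidable_rel R" and deep: "deep R omega1_CK y"
  shows "deep R \<gamma> y"
proof (cases "y \<in> Wellfounded.acc R")
  case True
  define D where "D = root_nodes R y"
  have D_iff: "t \<in> D \<longleftrightarrow> list_decode t \<in> extensions R [y]" for t
    using root_nodes_iff[of "list_decode t"] by (simp add: D_def)
  define r where "r = {(v, u). v \<in> D \<and> u \<in> D \<and> kb_code v u}"
  have kb_code: "kb_code v u \<longleftrightarrow> kb (list_decode v) (list_decode u)" if "v \<in> D" for v u
    using kb_code_iff[of "list_decode v" "list_decode u"] that
    by (auto simp: D_iff extensions_def walk_def)
  have "wf (kb_rel R [y])" using True by (rule wf_kb_rel) auto
  then have wf: "wf r"
    by (rule wf_subset[OF wf_inv_image[of _ list_decode]])
      (auto simp: r_def kb_rel_def D_iff kb_code)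
  have total: "v = u \<or> (v, u) \<in> r \<or> (u, v) \<in> r" if "v \<in> D" "u \<in> D" for u v
    using kb_total[of "list_decode v" "list_decode u"] that kb_code
    by (auto simp: r_def list_decode_eq)
  have sub: "r \<subseteq> D \<times> D" by (auto simp: r_def)
  obtain \<alpha> f
    where bij: "bij_betw f D {\<beta>. \<beta> < (\<alpha> :: cord)}"
      and f: "\<And>u v. u \<in> D \<Longrightarrow> v \<in> D \<Longrightarrow> (u, v) \<in> r \<longleftrightarrow> f u < f v"
    by (rule wellorder_iso_cord[OF wf sub total]) (assumption | blast)+
  have dD: "decidable (\<lambda>t. t \<in> D)"
    unfolding D_def root_nodes_def mem_Collect_eq by (intro computable decidable_node[OF R])
  have "decidable (\<lambda>z. pfst z \<in> D \<and> psnd z \<in> D \<and> kb_code (pfst z) (psnd z))"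
    unfolding kb_code_def by (intro computable decidable_comp[OF dD])
  moreover have "prod_encode ` r = {z. pfst z \<in> D \<and> psnd z \<in> D \<and> kb_code (pfst z) (psnd z)}"
    by (rule set_eqI) (simp add: in_image_prod_encode r_def case_prod_beta)
  ultimately have "computable_set (prod_encode ` r)" by (simp add: decidable_iff_computable_set)
  moreover have "computable_set D" using dD by (simp add: decidable_iff_computable_set)
  ultimately have "computable_ordinal \<alpha>"
    unfolding computable_ordinal_def using bij f \<open>r \<subseteq> D \<times> D\<close> by blast
  have y: "lcons y 0 \<in> D" by (simp add: D_iff extensions_def walk_def)
  have "omega1_CK \<le> f (lcons y 0)"
  proof (rule deep_imp_le_rank[where Z = D and g = lhd and R = R])
    fix t x assume t: "t \<in> D" and x: "(x, lhd t) \<in> R"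
    have "t \<noteq> 0" using t by (auto simp: D_iff extensions_def walk_def list_decode_0_iff)
    then have dt: "list_decode t = lhd t # list_decode (ltl t)" by (rule list_decode_conv)
    have "lcons x t \<in> D"
      using t x dt by (auto simp: D_iff extensions_def walk_def intro: suffix_Cons[THEN iffD2])
    moreover have "kb (list_decode (lcons x t)) (list_decode t)"
      by (simp add: kb_def strict_suffix_def suffix_def)
    ultimately have "(lcons x t, t) \<in> r" using t kb_code by (auto simp: r_def)
    then show "\<exists>s\<in>D. lhd s = x \<and> f s < f t"
      using f \<open>lcons x t \<in> D\<close> t by (intro bexI[of _ "lcons x t"]) auto
  qed (use y deep in auto)
  also have "\<dots> < \<alpha>" using y bij by (auto simp: bij_betw_def)
  also have "\<dots> < omega1_CK" using \<open>computable_ordinal \<alpha>\<close> by (simp add: less_omega1_CK_iff)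
  finally show ?thesis .
qed (rule not_acc_imp_deep)


section \<open>A universal graph\<close>

text \<open>
  A vertex consists of the index \<open>q\<close> of a program that is meant to decide a linear order, a point
  \<open>x\<close>, a counter and a witness. The point \<open>0\<close> is an artificial top element, and \<open>Suc d\<close> stands for the element \<open>d\<close>
  of the order. A step lowers the counter or passes to a smaller element with an arbitrary new counter. The
  counter serves to make walks of any prescribed number of steps available between two elements
  of the order. The witness of the new vertex certifies that its element is smaller.
\<close>

definition vertex :: "nat \<Rightarrow> nat \<Rightarrow> nat \<Rightarrow> nat \<Rightarrow> nat" where
  "vertex q x k w = prod_encode (q, prod_encode (x, prod_encode (k, w)))"
abbreviation index :: "nat \<Rightarrow> nat" where "index v \<equiv> pfst v"
abbreviation point :: "nat \<Rightarrow> nat" where "point v \<equiv> pfst (psnd v)"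
abbreviation counter :: "nat \<Rightarrow> nat" where "counter v \<equiv> pfst (psnd (psnd v))"
abbreviation witness :: "nat \<Rightarrow> nat" where "witness v \<equiv> psnd (psnd (psnd v))"

lemma vertex_simps [simp]: "index (vertex q x k w) = q" "point (vertex q x k w) = x"
  "counter (vertex q x k w) = k" "witness (vertex q x k w) = w"
  by (simp_all add: vertex_def)

definition universal_graph :: "(nat \<times> nat) set" where
  "universal_graph = {(v', v). index v' = index v \<and>
     (point v' = point v \<and> counter v' < counter v \<or>
      point v' \<noteq> 0 \<and> (point v = 0 \<or>
        accepts (witness v') (index v) (prod_encode (point v' - 1, point v - 1))))}"

lemma decidable_universal_graph: "decidable_rel universal_graph"
  unfolding decidable_rel_def universal_graph_def mem_Collect_eq case_prod_beta by (intro computable)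

lemma countdown: "(vertex q x k w, vertex q x (k + m) w) \<in> universal_graph ^^ m"
proof (induction m)
  case (Suc m)
  have "(vertex q x (k + m) w, vertex q x (k + Suc m) w) \<in> universal_graph"
    by (simp add: universal_graph_def)
  with Suc show ?case by (rule relpow_Suc_I)
qed simp

text \<open>
  To descend to depth \<open>\<gamma>\<close> in \<open>Suc n\<close> steps, first pass to the element of rank \<open>\<gamma>\<close> with counter \<open>n\<close>, then run the
  counter down.
\<close>

lemma deep_vertex:
  assumes bij: "bij_betw f D {\<beta>. \<beta> < \<alpha>}"
    and step: "\<And>x y. x \<in> D \<Longrightarrow> y \<in> D \<Longrightarrow> f x < f y \<Longrightarrow> \<exists>w. accepts w q (prod_encode (x, y))"
  shows "x = 0 \<and> \<beta> \<le> \<alpha> \<or> (\<exists>d\<in>D. x = Suc d \<and> \<beta> \<le> f d) \<Longrightarrow> deep universal_graph \<beta> (vertex q x k w)"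
proof (induction \<beta> arbitrary: x k w rule: less_induct)
  case (less \<beta>)
  show ?case
  proof (subst deep.simps, intro allI impI)
    fix \<gamma> m assume \<gamma>: "\<gamma> < \<beta>"
    have le: "f d < \<alpha>" if "d \<in> D" for d using that bij by (auto simp: bij_betw_def)
    show "\<exists>v. (v, vertex q x k w) \<in> universal_graph ^^ m \<and> deep universal_graph \<gamma> v"
    proof (cases m)
      case 0
      have "deep universal_graph \<gamma> (vertex q x k w)"
        using less.prems \<gamma> by (intro less.IH[OF \<gamma>]) auto
      then show ?thesis using 0 by auto
    next
      case (Suc n)
      have "\<beta> \<le> \<alpha>" using less.prems le by (blast intro: less_imp_le order.trans)
      then have "\<gamma> < \<alpha>" using \<gamma> by simp
      then have "\<gamma> \<in> f ` D" using bij by (simp add: bij_betw_def)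
      then obtain d where d: "d \<in> D" "f d = \<gamma>" by blast
      have "\<exists>w'. (vertex q (Suc d) n w', vertex q x k w) \<in> universal_graph"
        using less.prems
      proof (elim disjE bexE conjE)
        fix e assume e: "e \<in> D" "x = Suc e" "\<beta> \<le> f e"
        have "f d < f e" using d(2) \<gamma> e(3) by simp
        then obtain w' where "accepts w' q (prod_encode (d, e))" using step[OF d(1) e(1)] by blast
        then show ?thesis using e by (intro exI[of _ w']) (simp add: universal_graph_def)
      qed (simp add: universal_graph_def)
      then obtain w' where "(vertex q (Suc d) (0 + n) w', vertex q x k w) \<in> universal_graph" by auto
      from relpow_Suc_I[OF countdown this]
      have "(vertex q (Suc d) 0 w', vertex q x k w) \<in> universal_graph ^^ m" using Suc by simp
      moreover have "deep universal_graph \<gamma> (vertex q (Suc d) 0 w')"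
        using d by (intro less.IH[OF \<gamma>]) auto
      ultimately show ?thesis by blast
    qed
  qed
qed

text \<open>
  For a program that decides the order relation of a presentation of \<open>\<alpha>\<close>, the top vertex is deep to
  \<open>\<alpha>\<close>. The part of the graph with this index is well-founded, because each step lowers the
  element or keeps it and lowers the counter; so the depth of the top vertex is bounded.
\<close>

lemma universal_graph_depths:
  assumes "\<alpha> < omega1_CK"
  shows "\<exists>v \<gamma>. deep universal_graph \<alpha> v \<and> \<not> deep universal_graph \<gamma> v"
proof -
  obtain D R f where R: "computable_set (prod_encode ` R)" and sub: "R \<subseteq> D \<times> D"
    and bij: "bij_betw f D {\<beta>. \<beta> < \<alpha>}"
    and iff: "\<And>x y. x \<in> D \<Longrightarrow> y \<in> D \<Longrightarrow> (x, y) \<in> R \<longleftrightarrow> f x < f y"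
    using assms unfolding less_omega1_CK_iff computable_ordinal_def by metis
  obtain q where q: "prod_encode ` R = {z. \<exists>w. accepts w q z}" using computable_set_accepts[OF R] by blast
  have acc: "(x, y) \<in> R \<longleftrightarrow> (\<exists>w. accepts w q (prod_encode (x, y)))" for x y
    using q in_image_prod_encode[of "prod_encode (x, y)" R] by auto
  let ?v = "vertex q 0 0 0"
  have deep: "deep universal_graph \<alpha> ?v"
  proof (rule deep_vertex[OF bij])
    show "\<exists>w. accepts w q (prod_encode (x, y))" if "x \<in> D" "y \<in> D" "f x < f y" for x y
      using that iff acc by blast
  qed simp
  obtain \<delta> where \<delta>: "\<And>x. f x < \<delta>" using cord_bounded[of "range f"] by auto
  \<comment> \<open>Points that do not belong to the order receive arbitrary values, which must still lie below the top.\<close>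
  define F where "F v = (if point v = 0 then \<delta> else f (point v - 1))" for v
  define T where "T = {(v', v). (v', v) \<in> universal_graph \<and> index v = q}"
  have "wf ({(\<beta>, \<gamma>). \<beta> < (\<gamma> :: cord)} <*lex*> less_than)"
    by (intro wf_lex_prod wf wf_less_than)
  then have "wf T"
  proof (rule wf_subset[OF wf_inv_image[of _ "\<lambda>v. (F v, counter v)"]])
    have R_less: "f x < f y" if "accepts w q (prod_encode (x, y))" for x y w
      using that acc iff sub by blast
    show "T \<subseteq> inv_image ({(\<beta>, \<gamma>). \<beta> < (\<gamma> :: cord)} <*lex*> less_than) (\<lambda>v. (F v, counter v))"
    proof (rule subrelI)
      fix v' v assume "(v', v) \<in> T"
      then consider "point v' = point v" "counter v' < counter v" | "point v' \<noteq> 0" "point v = 0"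
        | "point v' \<noteq> 0" "point v \<noteq> 0" "accepts (witness v') q (prod_encode (point v' - 1, point v - 1))"
        unfolding T_def universal_graph_def by auto
      then have "F v' < F v \<or> F v' = F v \<and> counter v' < counter v"
        by cases (use \<delta> R_less in \<open>auto simp: F_def\<close>)
      then show "(v', v) \<in> inv_image ({(\<beta>, \<gamma>). \<beta> < \<gamma>} <*lex*> less_than) (\<lambda>v. (F v, counter v))"
        by auto
    qed
  qed
  then obtain g :: "nat \<Rightarrow> cord" where g: "\<And>x y. (y, x) \<in> T \<Longrightarrow> g y < g x"
    using rank_function by metis
  obtain \<gamma> where \<gamma>: "g ?v < \<gamma>" using cord_bounded[of "{g ?v}"] by auto
  have "\<gamma> \<le> g ?v" if "deep universal_graph \<gamma> ?v"
  proof (rule deep_imp_le_rank[where Z = "{v. index v = q}" and g = "\<lambda>v. v"])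
    show "\<exists>b\<in>{v. index v = q}. b = y \<and> g b < g a"
      if "a \<in> {v. index v = q}" "(y, a) \<in> universal_graph" for a y
      using that g[of y a] by (auto simp: T_def universal_graph_def)
  qed (use that in auto)
  then have "\<not> deep universal_graph \<gamma> ?v" using \<gamma> by auto
  with deep show ?thesis by blast
qed


section \<open>The structure is computable\<close>

lemma decidable_univ_torsor:
  assumes R: "decidable_rel R" shows "decidable (\<lambda>X. X \<in> univ (torsor R))"
proof -
  have "X \<in> univ (torsor R) \<longleftrightarrow> (\<forall>t\<le>X. t \<in> elt X \<longrightarrow> node R (lev X) t)" for X
  proof -
    have "t \<le> X" if "t \<in> elt X" for t
      using set_decode_less[OF that] le_prod_encode_2[of "psnd X" "lev X"] by simp
    then show ?thesis by (auto simp: univ_torsor nodesets_def)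
  qed
  then show ?thesis by (simp only:) (intro computable decidable_node[OF R])
qed

text \<open>
  The members of all sets involved are bounded by the codes \<open>g\<close>, \<open>X\<close> and \<open>Y\<close>, so the equality of sets and
  the parity in \<open>push\<close> reduce to bounded quantification and counting.
\<close>

lemma decidable_torsor_rel:
  assumes f: "computable_fun f" and X: "computable_fun X" and Y: "computable_fun Y"
  shows "decidable (\<lambda>e. torsor_rel (f e) (X e) (Y e))"
proof -
  have bound: "t < X" if "t \<in> elt X" for t X
    using set_decode_less[OF that] le_prod_encode_2[of "psnd X" "lev X"] by simp
  have push: "u \<in> push (ldrop k) (elt X) \<longleftrightarrow>
      \<not> even (card {t. t < X \<and> (t \<in> elt X \<and> ldrop k t = u)})" for u k X
  proof -
    have "{t \<in> elt X. ldrop k t = u} = {t. t < X \<and> (t \<in> elt X \<and> ldrop k t = u)}"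
      using bound by blast
    then show ?thesis by (simp add: push_def)
  qed
  have "torsor_rel g X Y \<longleftrightarrow> lev Y = lev g \<and> lev Y \<le> lev X \<and>
      (\<forall>u\<le>g + X + Y. u \<in> elt Y \<longleftrightarrow> (u \<in> push (ldrop (lev X - lev Y)) (elt X) \<longleftrightarrow> \<not> u \<in> elt g))"
    for g X Y
  proof -
    have "u < X" if "u \<in> push (ldrop k) (elt X)" for u k
      using that push_subset[of "ldrop k" "elt X"] bound ldrop_le le_less_trans by blast
    then have "u \<le> g + X + Y"
      if "u \<in> elt Y \<or> u \<in> push (ldrop (lev X - lev Y)) (elt X) \<or> u \<in> elt g" for u
      using that bound[of u Y] bound[of u g] by (meson less_imp_le trans_le_add1 trans_le_add2)
    then show ?thesis unfolding torsor_rel_def set_eq_iff in_xor by blast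
  qed
  then have "decidable (\<lambda>e. torsor_rel (pfst e) (pfst (psnd e)) (psnd (psnd e)))"
    unfolding push by (simp only:) (intro computable)
  then have "decidable (\<lambda>e. torsor_rel (pfst (prod_encode (f e, prod_encode (X e, Y e))))
      (pfst (psnd (prod_encode (f e, prod_encode (X e, Y e)))))
      (psnd (psnd (prod_encode (f e, prod_encode (X e, Y e))))))"
    by (rule decidable_comp) (intro computable f X Y)
  then show ?thesis by simp
qed

lemma computable_torsor:
  assumes R: "decidable_rel R" shows "computable_structure torsor_lang (torsor R)"
proof -
  let ?U = "univ (torsor R)"
  note U = decidable_univ_torsor[OF R]
  have "element 0 {} \<in> ?U" by (simp add: element_in_univ nodesets_def)
  then have "is_structure torsor_lang (torsor R)"
    by (auto simp: is_structure_def torsor_lang_def)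
  moreover have "computable_set ?U" using U by (simp add: decidable_iff_computable_set)
  moreover have "computable_set {prod_encode (r, list_encode as) | r as. r \<in> Rels torsor_lang \<and>
      as \<in> lists ?U \<and> length as = rel_arity torsor_lang r \<and> rel (torsor R) r as}"
  proof -
    let ?x = "\<lambda>z. lhd (psnd z)" and ?y = "\<lambda>z. lhd (ltl (psnd z))"
    have "decidable (\<lambda>z. psnd z = lcons (?x z) (lcons (?y z) 0) \<and> ?x z \<in> ?U \<and> ?y z \<in> ?U \<and>
        torsor_rel (pfst z) (?x z) (?y z))"
      by (intro computable decidable_comp[OF U] decidable_torsor_rel)
    moreover have "psnd z = lcons (?x z) (lcons (?y z) 0) \<and> ?x z \<in> ?U \<and> ?y z \<in> ?U \<and>
        torsor_rel (pfst z) (?x z) (?y z) \<longleftrightarrow>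
        (\<exists>r as. z = prod_encode (r, list_encode as) \<and> as \<in> lists ?U \<and> length as = 2 \<and>
          torsor_rel r (as ! 0) (as ! 1))" (is "?L \<longleftrightarrow> ?R") for z
    proof
      assume L: ?L
      have "z = prod_encode (pfst z, psnd z)" by simp
      also have "psnd z = list_encode [?x z, ?y z]" using L by (simp only: list_encode_Cons list_encode.simps)
      finally have "z = prod_encode (pfst z, list_encode [?x z, ?y z])" .
      then show ?R using L by (intro exI[of _ "pfst z"] exI[of _ "[?x z, ?y z]"]) simp
    next
      assume ?R
      then obtain r x y where "z = prod_encode (r, list_encode [x, y])" "x \<in> ?U" "y \<in> ?U" "torsor_rel r x y"
        by (auto simp: length_Suc_conv numeral_2_eq_2)
      then show ?L by (simp add: list_encode_Cons del: list_encode.simps(2))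
    qed
    ultimately show ?thesis
      by (simp add: decidable_iff_computable_set torsor_lang_def torsor_def)
  qed
  moreover have "\<exists>g. computable_fun g \<and> (\<forall>f\<in>Funs torsor_lang. \<forall>as\<in>lists ?U.
      length as = fun_arity torsor_lang f \<longrightarrow> g (prod_encode (f, list_encode as)) = fn (torsor R) f as)"
    by (rule exI[of _ "\<lambda>x. x"]) (simp add: torsor_lang_def computable_id)
  ultimately show ?thesis unfolding computable_structure_def by blast
qed

lemma computable_torsor_lang: "computable_language torsor_lang"
  by (simp add: computable_language_def torsor_lang_def computable_set_def computable_const)


section \<open>Scott rank and indiscernibles\<close>

text \<open>
  The singletons of a triple have the same level \<open>n\<close>. The relation \<open>g\<close> that describes \<open>a 2\<close> over \<open>a 1\<close> must also hold
  of \<open>a 1\<close> and \<open>a 3\<close>, but over a fixed \<open>a 1\<close> it has only one solution.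
\<close>

lemma torsor_no_indiscernible_triple: "\<not> indiscernible_triple torsor_lang (torsor R) a"
proof
  assume ind: "indiscernible_triple torsor_lang (torsor R) a"
  have same: "torsor_rel g (a i) (a j) \<longleftrightarrow> torsor_rel g (a i') (a j')"
    if "i \<in> {1..3}" "j \<in> {1..3}" "i' \<in> {1..3}" "j' \<in> {1..3}" "i < j" "i' < j'" for g i j i' j'
  proof -
    have "same_formulas torsor_lang (torsor R) (map a [i, j]) (map a [i', j'])"
      using ind[unfolded indiscernible_triple_def, THEN conjunct2, THEN conjunct2,
          rule_format, of "[i, j]" "[i', j']"] that by simp
    moreover have "Rel g [Var 0, Var 1] \<in> formulas torsor_lang 2"
      by (auto simp: formulas_def torsor_lang_def)
    ultimately show ?thesis by (fastforce simp: same_formulas_def torsor_def numeral_2_eq_2)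
  qed
  have lev: "lev (a i) = lev (a 1)" if "i \<in> {1..3}" for i
  proof -
    have "same_formulas torsor_lang (torsor R) (map a [1]) (map a [i])"
      using ind[unfolded indiscernible_triple_def, THEN conjunct2, THEN conjunct2,
          rule_format, of "[1]" "[i]"] that by simp
    moreover have "Rel (element (lev (a 1)) {}) [Var 0, Var 0] \<in> formulas torsor_lang 1"
      by (auto simp: formulas_def torsor_lang_def)
    ultimately have "torsor_rel (element (lev (a 1)) {}) (a 1) (a 1) \<longleftrightarrow> torsor_rel (element (lev (a 1)) {}) (a i) (a i)"
      by (fastforce simp: same_formulas_def torsor_def)
    then show ?thesis by (simp add: torsor_rel_def)
  qed
  define g where "g = element (lev (a 1)) (elt (a 1) \<oplus> elt (a 2))"
  have "torsor_rel g (a 1) (a 2)" using lev[of 2] by (simp add: torsor_rel_def g_def)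
  then have "torsor_rel g (a 1) (a 3)" using same[of 1 2 1 3] by simp
  then have "elt (a 3) = elt (a 2)" using lev[of 3] by (simp add: torsor_rel_def g_def)
  then have "a 3 = a 2" using lev[of 2] lev[of 3] by (intro element_eqI[OF _ \<open>elt (a 3) = elt (a 2)\<close>]) simp
  moreover have "inj_on a {1..3}" using ind by (simp add: indiscernible_triple_def)
  ultimately show False using inj_onD[of a "{1..3}" 3 2] by simp
qed

text \<open>
  The one-element tuple of the empty set in level \<open>0\<close> has Scott rank \<open>\<omega>\<^sub>1\<^sup>C\<^sup>K\<close>: for \<open>\<alpha> < \<omega>\<^sub>1\<^sup>C\<^sup>K\<close> and a vertex \<open>y\<close>
  that is deep to \<open>\<alpha>\<close> but not to \<open>\<gamma>\<close>, the singleton of the trivial walk at \<open>y\<close> is \<open>\<alpha>\<close>-equivalent, but not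
  \<open>\<gamma>\<close>-equivalent to the empty set. This is the largest rank of a tuple, since \<open>\<omega>\<^sub>1\<^sup>C\<^sup>K\<close>-equivalence implies
  \<open>\<gamma>\<close>-equivalence for all \<open>\<gamma>\<close>.
\<close>

lemma scott_rank_torsor:
  assumes R: "decidable_rel R"
    and depths: "\<And>\<alpha>. \<alpha> < omega1_CK \<Longrightarrow> \<exists>y \<gamma>. deep R \<alpha> y \<and> \<not> deep R \<gamma> y"
  shows "scott_rank torsor_lang (torsor R) = cord_succ omega1_CK"
proof -
  let ?M = "torsor R"
  let ?stable = "\<lambda>as \<alpha>. \<forall>bs\<in>lists (univ ?M). length bs = length as \<longrightarrow>
      back_forth torsor_lang ?M \<alpha> as bs \<longrightarrow> (\<forall>\<gamma>>\<alpha>. back_forth torsor_lang ?M \<gamma> as bs)"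
  have stable: "?stable as omega1_CK" if as: "as \<in> lists (univ ?M)" for as
  proof (intro ballI impI allI)
    fix bs \<gamma> assume bs: "bs \<in> lists (univ ?M)" and "back_forth torsor_lang ?M omega1_CK as bs"
    then have "deep_shift R omega1_CK as bs" using back_forth_imp_deep_shift as by blast
    then have "deep_shift R \<gamma> as bs" unfolding deep_shift_def using deep_omega1_CK[OF R] by blast
    then show "back_forth torsor_lang ?M \<gamma> as bs" using deep_shift_imp_back_forth as bs by blast
  qed
  have le: "tuple_scott_rank torsor_lang ?M as \<le> omega1_CK" if "as \<in> lists (univ ?M)" for as
    unfolding tuple_scott_rank_def by (rule Least_le) (rule stable[OF that])
  let ?a = "element 0 {}"
  have a: "[?a] \<in> lists (univ ?M)" by (simp add: element_in_univ nodesets_def)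
  have "\<not> ?stable [?a] \<alpha>" if "\<alpha> < omega1_CK" for \<alpha>
  proof
    assume st: "?stable [?a] \<alpha>"
    obtain y \<gamma> where y: "deep R \<alpha> y" "\<not> deep R \<gamma> y" using depths[OF \<open>\<alpha> < omega1_CK\<close>] by blast
    let ?b = "element 0 {lcons y 0}"
    have n: "node R 0 (lcons y 0)" by (simp add: node_0)
    have b: "[?b] \<in> lists (univ ?M)" using n by (simp add: element_in_univ nodesets_def)
    have shift: "shift 0 {lcons y 0} ?a = ?b" by (simp add: shift_def xor_commute[of "{}"])
    have "deep_shift R \<alpha> [?a] [?b]"
      unfolding deep_shift_def using n y(1) shift
      by (intro exI[of _ 0] exI[of _ "{lcons y 0}"]) (simp add: nodesets_def)
    then have "back_forth torsor_lang ?M \<alpha> [?a] [?b]" using a b by (rule deep_shift_imp_back_forth)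
    moreover have "\<alpha> < \<gamma>" using y deep_antimono not_le by blast
    ultimately have "back_forth torsor_lang ?M \<gamma> [?a] [?b]" using st b by simp
    then have "deep_shift R \<gamma> [?a] [?b]" using a b by (rule back_forth_imp_deep_shift)
    then obtain N h where h: "h \<in> nodesets R N" "?b = shift N h ?a" and deep: "\<forall>t\<in>h. deep R \<gamma> (lhd t)"
      by (auto simp: deep_shift_def)
    have fin: "finite h" using h(1) by (simp add: nodesets_def)
    have "{lcons y 0} = push (ldrop N) h"
      using arg_cong[OF h(2), of elt] elt_shift[OF fin, of N ?a] by (simp add: xor_commute[of "{}"])
    then obtain t where t: "t \<in> h" "ldrop N t = lcons y 0" using push_subset[of "ldrop N" h] by auto
    have "node R (0 + N) t" using t h(1) by (simp add: nodesets_def)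
    from node_ldrop[OF this] t have "(lhd t, y) \<in> R ^^ N" by simp
    then have "deep R \<gamma> y" using deep_reachable deep t(1) by blast
    with y(2) show False ..
  qed
  moreover have "?stable [?a] (tuple_scott_rank torsor_lang ?M [?a])"
    unfolding tuple_scott_rank_def by (rule LeastI[of "?stable [?a]"]) (rule stable[OF a])
  ultimately have eq: "tuple_scott_rank torsor_lang ?M [?a] = omega1_CK"
    using le[OF a] by (metis order.not_eq_order_implies_strict)
  have "(\<forall>as\<in>lists (univ ?M). tuple_scott_rank torsor_lang ?M as < \<alpha>) \<longleftrightarrow> omega1_CK < \<alpha>" for \<alpha>
    using le eq a by (metis le_less_trans)
  then show ?thesis by (simp only: scott_rank_def cord_succ_def)
qed

theorem theorem3p1:
  shows "\<exists>(L :: language) (M :: nat struct).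
    computable_language L \<and> computable_structure L M \<and>
    scott_rank L M = cord_succ omega1_CK \<and>
    \<not> (\<exists>a. indiscernible_triple L M a)"
  using computable_torsor_lang computable_torsor[OF decidable_universal_graph]
    scott_rank_torsor[OF decidable_universal_graph universal_graph_depths]
    torsor_no_indiscernible_triple by blast

end
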